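(* Let $K$ be a finite prime field of cardinality $q$. For any nonempty subset $X$ of some polynomial generic representation $P$ over $K$, there exist a finite-dimensional $K$-vector space $U$, a nonzero function $h$ on $X(U)$ (i.e. a function $h\in K[P(U)]$ that does not vanish identically on $X(U)$), and a polynomial $A(n)\in\mathbb{Q}[n]$ such that for all $n\in\mathbb{N}$ the cardinality of $(\mathrm{Sh}_UX)[1/h](K^n)$ equals $q^{A(n)}$.
   Context: Let $\mathbf{Vec}$ be the category of finite-dimensional $K$-vector spaces. For $V\in\mathbf{Vec}$, $K[V]$ is the $K$-algebra of all functions $V\to K$, and $K[V]_{\le e}$ is the subspace of functions given by a polynomial of degree at most $e$ in linear coordinates. A polynomial generic representation is a functor $P:\mathbf{Vec}\to\mathbf{Vec}$ for which there is a $d$ such that for all $U,V$ the map $P:\mathrm{Hom}(U,V)\to\mathrm{Hom}(P(U),P(V))$ lies in $K[\mathrm{Hom}(U,V)]_{\le d}\otimes\mathrm{Hom}(P(U),P(V))$. A subset $X$ of $P$ is the data of a subset $X(V)\subseteq P(V)$ for every $V\in\mathbf{Vec}$ with $P(\phi)X(V)\subseteq X(W)$ for all $\phi\in\mathrm{Hom}(V,W)$; it is nonempty if some $X(V)$ is nonempty. For $U\in\mathbf{Vec}$, $(\mathrm{Sh}_UX)(V):=X(U\oplus V)\subseteq P(U\oplus V)$. For $h\in K[P(U)]$, view $h$ as a function on $P(U\oplus V)$ by pullback along $P(\mathrm{pr}_U):P(U\oplus V)\to P(U)$, where $\mathrm{pr}_U:U\oplus V\to U$ is the projection; then $(\mathrm{Sh}_UX)[1/h](V):=\{p\in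 X(U\oplus V): h(p)\neq0\}$. *)

theory Defs
  imports
    Complex_Main
    "HOL-Computational_Algebra.Primes"
    "HOL-Computational_Algebra.Polynomial"
    "Jordan_Normal_Form.Missing_VectorSpace"
begin

definition fd_vectorspace :: "('k, 'm) ring_scheme \<Rightarrow> ('k, 'v) module \<Rightarrow> bool" where
  "fd_vectorspace K V \<longleftrightarrow> vectorspace K V \<and> vectorspace.fin_dim K V"

text \<open>
  Linear maps are extensional (\<open>undefined\<close> outside the domain), so that two of them are equal
  as soon as they agree on the domain. The fields \<open>mult\<close> and \<open>one\<close> of a module record play no role.
\<close>

definition Hom_space ::
  "('k, 'm) ring_scheme \<Rightarrow> ('k, 'v) module \<Rightarrow> ('k, 'w) module \<Rightarrow> ('k, 'v \<Rightarrow> 'w) module" where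
  "Hom_space K V W =
     \<lparr> carrier = module_hom K V W \<inter> extensional (carrier V),
       mult = (\<lambda>f g. \<lambda>v\<in>carrier V. \<zero>\<^bsub>W\<^esub>),
       one = (\<lambda>v\<in>carrier V. \<zero>\<^bsub>W\<^esub>),
       zero = (\<lambda>v\<in>carrier V. \<zero>\<^bsub>W\<^esub>),
       add = (\<lambda>f g. \<lambda>v\<in>carrier V. f v \<oplus>\<^bsub>W\<^esub> g v),
       smult = (\<lambda>c f. \<lambda>v\<in>carrier V. c \<odot>\<^bsub>W\<^esub> f v) \<rparr>"

abbreviation Hom ::
  "('k, 'm) ring_scheme \<Rightarrow> ('k, 'v) module \<Rightarrow> ('k, 'w) module \<Rightarrow> ('v \<Rightarrow> 'w) set" where
  "Hom K V W \<equiv> carrier (Hom_space K V W)"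

definition functions_on :: "('k, 'm) ring_scheme \<Rightarrow> ('k, 'v) module \<Rightarrow> ('v \<Rightarrow> 'k) set" where
  "functions_on K V = carrier V \<rightarrow>\<^sub>E carrier K"

definition coordinates ::
  "('k, 'm) ring_scheme \<Rightarrow> ('k, 'v) module \<Rightarrow> 'v set \<Rightarrow> 'v \<Rightarrow> ('v \<Rightarrow> 'k)" where
  "coordinates K V B v = (THE a. a \<in> B \<rightarrow>\<^sub>E carrier K \<and> module.lincomb V a B = v)"

definition exponents :: "'v set \<Rightarrow> nat \<Rightarrow> ('v \<Rightarrow> nat) set" where
  "exponents B e = {\<alpha> \<in> B \<rightarrow>\<^sub>E UNIV. (\<Sum>b\<in>B. \<alpha> b) \<le> e}"

text \<open>
  The set \<open>K[V]\<^bsub>\<le>e\<^esub>\<close>. Whether a function belongs to it does not depend on the basis \<open>B\<close> that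
  provides the linear coordinates.
\<close>

definition polynomial_functions ::
  "('k, 'm) ring_scheme \<Rightarrow> ('k, 'v) module \<Rightarrow> nat \<Rightarrow> ('v \<Rightarrow> 'k) set" where
  "polynomial_functions K V e =
     {f \<in> functions_on K V.
        \<exists>B c. finite B \<and> vectorspace.basis K V B \<and> c \<in> exponents B e \<rightarrow> carrier K \<and>
          (\<forall>v\<in>carrier V. f v =
             (\<Oplus>\<^bsub>K\<^esub>\<alpha>\<in>exponents B e.
                c \<alpha> \<otimes>\<^bsub>K\<^esub> (\<Otimes>\<^bsub>K\<^esub>b\<in>B. coordinates K V B v b [^]\<^bsub>K\<^esub> \<alpha> b)))}"

text \<open>
  The elements of \<open>K[V]\<^bsub>\<le>e\<^esub> \<otimes> W\<close>, a tensor \<open>\<Sum>\<^sub>i f\<^sub>i \<otimes> w\<^sub>i\<close> being regarded as the map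
  \<open>v \<mapsto> \<Sum>\<^sub>i f\<^sub>i(v) w\<^sub>i\<close> from \<open>V\<close> to \<open>W\<close>.
\<close>

definition polynomial_maps ::
  "('k, 'm) ring_scheme \<Rightarrow> ('k, 'v) module \<Rightarrow> ('k, 'w) module \<Rightarrow> nat \<Rightarrow> ('v \<Rightarrow> 'w) set" where
  "polynomial_maps K V W e =
     {g \<in> carrier V \<rightarrow> carrier W.
        \<exists>(n::nat) f w. (\<forall>i<n. f i \<in> polynomial_functions K V e \<and> w i \<in> carrier W) \<and>
          (\<forall>v\<in>carrier V. g v = (\<Oplus>\<^bsub>W\<^esub>i\<in>{..<n}. f i v \<odot>\<^bsub>W\<^esub> w i))}"

text \<open>
  The objects of the category are the finite-dimensional vector spaces whose elements belong to
  the following type. It contains the elements of \<open>K\<^sup>n\<close> and is closed under pairing, so that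
  \<open>K\<^sup>n\<close> and \<open>U \<oplus> V\<close> are objects. Through \<open>Atom\<close>, with \<open>'a\<close> an arbitrary type, a copy
  of every finite-dimensional vector space on any type occurs as an object.
\<close>

datatype ('k, 'a) elem =
    Atom 'a
  | Tuple "nat \<Rightarrow> 'k"
  | Couple (left: "('k, 'a) elem") (right: "('k, 'a) elem")

type_synonym ('k, 'a) space = "('k, ('k, 'a) elem) module"

text \<open>Transport of structure along a map \<open>f\<close> that is injective on \<open>V\<close>.\<close>

definition image_module :: "('v \<Rightarrow> 'w) \<Rightarrow> ('k, 'v) module \<Rightarrow> ('k, 'w) module" where
  "image_module f V = (let g = inv_into (carrier V) f in
     \<lparr> carrier = f ` carrier V,
       mult = (\<lambda>x y. f (g x \<otimes>\<^bsub>V\<^esub> g y)),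
       one = f \<one>\<^bsub>V\<^esub>,
       zero = f \<zero>\<^bsub>V\<^esub>,
       add = (\<lambda>x y. f (g x \<oplus>\<^bsub>V\<^esub> g y)),
       smult = (\<lambda>c x. f (c \<odot>\<^bsub>V\<^esub> g x)) \<rparr>)"

definition coordinate_space :: "('k, 'm) ring_scheme \<Rightarrow> nat \<Rightarrow> ('k, 'a) space" where
  "coordinate_space K n = image_module Tuple (ring.func_space K {..<n})"

definition dsum :: "('k, 'a) space \<Rightarrow> ('k, 'a) space \<Rightarrow> ('k, 'a) space" where
  "dsum U V = image_module (\<lambda>(u, v). Couple u v) (direct_sum U V)"

definition proj_left ::
  "('k, 'a) space \<Rightarrow> ('k, 'a) space \<Rightarrow> ('k, 'a) elem \<Rightarrow> ('k, 'a) elem" where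
  "proj_left U V = (\<lambda>x\<in>carrier (dsum U V). left x)"

text \<open>
  The functor sends an object \<open>V\<close> to \<open>P V\<close> and a linear map \<open>\<phi>\<close> from \<open>U\<close> to \<open>V\<close> to
  \<open>Pm U V \<phi>\<close>. The spaces \<open>P V\<close> may have their elements in any type.
\<close>

locale generic_representation =
  fixes K :: "('k, 'm) ring_scheme"
    and P :: "('k, 'a) space \<Rightarrow> ('k, 'w) module"
    and Pm :: "('k, 'a) space \<Rightarrow> ('k, 'a) space
                 \<Rightarrow> (('k, 'a) elem \<Rightarrow> ('k, 'a) elem) \<Rightarrow> ('w \<Rightarrow> 'w)"
  assumes object: "fd_vectorspace K V \<Longrightarrow> fd_vectorspace K (P V)"
    and morphism:
      "\<lbrakk> fd_vectorspace K U; fd_vectorspace K V; \<phi> \<in> Hom K U V \<rbrakk>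
        \<Longrightarrow> Pm U V \<phi> \<in> Hom K (P U) (P V)"
    and identity:
      "fd_vectorspace K V \<Longrightarrow> Pm V V (\<lambda>v\<in>carrier V. v) = (\<lambda>p\<in>carrier (P V). p)"
    and composition:
      "\<lbrakk> fd_vectorspace K U; fd_vectorspace K V; fd_vectorspace K W;
         \<phi> \<in> Hom K U V; \<psi> \<in> Hom K V W \<rbrakk>
        \<Longrightarrow> Pm U W (compose (carrier U) \<psi> \<phi>)
              = compose (carrier (P U)) (Pm V W \<psi>) (Pm U V \<phi>)"

locale polynomial_generic_representation = generic_representation +
  assumes polynomial:
    "\<exists>d. \<forall>U V. fd_vectorspace K U \<longrightarrow> fd_vectorspace K V \<longrightarrow>
       Pm U V \<in> polynomial_maps K (Hom_space K U V) (Hom_space K (P U) (P V)) d"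

definition is_subset ::
  "('k, 'm) ring_scheme \<Rightarrow> (('k, 'a) space \<Rightarrow> ('k, 'w) module)
    \<Rightarrow> (('k, 'a) space \<Rightarrow> ('k, 'a) space \<Rightarrow> (('k, 'a) elem \<Rightarrow> ('k, 'a) elem) \<Rightarrow> ('w \<Rightarrow> 'w))
    \<Rightarrow> (('k, 'a) space \<Rightarrow> 'w set) \<Rightarrow> bool" where
  "is_subset K P Pm X \<longleftrightarrow>
     (\<forall>V. fd_vectorspace K V \<longrightarrow> X V \<subseteq> carrier (P V)) \<and>
     (\<forall>V W. fd_vectorspace K V \<longrightarrow> fd_vectorspace K W \<longrightarrow>
        (\<forall>\<phi>\<in>Hom K V W. Pm V W \<phi> ` X V \<subseteq> X W))"

definition nonempty_subset ::
  "('k, 'm) ring_scheme \<Rightarrow> (('k, 'a) space \<Rightarrow> 'w set) \<Rightarrow> bool" where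
  "nonempty_subset K X \<longleftrightarrow> (\<exists>V. fd_vectorspace K V \<and> X V \<noteq> {})"

definition Sh :: "('k, 'a) space \<Rightarrow> (('k, 'a) space \<Rightarrow> 'w set) \<Rightarrow> (('k, 'a) space \<Rightarrow> 'w set)" where
  "Sh U X = (\<lambda>V. X (dsum U V))"

definition Sh_localized ::
  "('k, 'm) ring_scheme
    \<Rightarrow> (('k, 'a) space \<Rightarrow> ('k, 'a) space \<Rightarrow> (('k, 'a) elem \<Rightarrow> ('k, 'a) elem) \<Rightarrow> ('w \<Rightarrow> 'w))
    \<Rightarrow> ('k, 'a) space \<Rightarrow> (('k, 'a) space \<Rightarrow> 'w set) \<Rightarrow> ('w \<Rightarrow> 'k)
    \<Rightarrow> (('k, 'a) space \<Rightarrow> 'w set)" where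
  "Sh_localized K Pm U X h =
     (\<lambda>V. {p \<in> Sh U X V. h (Pm (dsum U V) U (proj_left U V) p) \<noteq> \<zero>\<^bsub>K\<^esub>})"

end

theory Submission
  imports
    Defs
    "HOL-Library.Function_Algebras"
    "HOL-Number_Theory.Number_Theory"
begin

text \<open>
  Take for \<open>h\<close> the indicator function of a set of points. A point \<open>x\<close> of \<open>X(U)\<close> has a stabilizer,
  the largest subfunctor of \<open>P\<close> by which the points over \<open>x\<close> can be translated within \<open>X\<close>; it grows
  when \<open>x\<close> is replaced by a point over \<open>x\<close>, and as a functor of bounded degree it is determined by its
  value at a single space, so it can be assumed to be maximal. Considering, for each of the finitely
  many non-stabilizing elements at that space, points over \<open>x\<close> at which a certain indicator function
  has maximal degree, one finds \<open>x\<close> such that two points over \<open>x\<close> in \<open>X(U \<oplus> V)\<close> that differ by an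
  element of \<open>P(V)\<close> differ by an element of the stabilizer. Hence, over \<open>x\<close>, the map to \<open>P(U \<oplus> V) / P(V)\<close>
  has fibres that are cosets of the stabilizer. Since the target has smaller degree as a functor of
  \<open>V\<close>, induction on the degree applies to the image.

  Over a prime field, subgroups are subspaces and degrees can be measured by iterated differences;
  therefore only the action of integer matrices on finite abelian groups is used.
\<close>

section \<open>Iterated differences\<close>

text \<open>The set \<open>X\<close> is closed under the action of matrices and nothing else, so no
  equations are available; finiteness takes their place. Every function on a finite group of
  exponent p is polynomial, and for a fixed target K^n the functions sending A to the truth value of
  \<open>F m n A y \<in> Z\<close> have degree bounded independently of the source m and of y. This
  is why a maximal degree exists although the points over x live over ever larger spaces. P(U + V) /
  P(V) has smaller degree in V because its elements are killed by all 0 + A, and the leading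
  differences of a functor do not see the constant part of 1 + A. As P(V) is a direct summand, the
  quotient is realized as the kernel of P(U + V) -> P(V), and no quotient groups are formed. The
  exponent is a sum of two contributions: one from the induction, and the dimension of the
  stabilizer. The latter is polynomial since its increments from n to n + 1 are the dimensions of a
  functor of smaller degree. The induction returns a set of points over U, not a single one; hence h
  is the indicator function of a set.\<close>

primrec iter_diff :: "'a::ab_group_add list \<Rightarrow> ('a \<Rightarrow> 'b::ab_group_add) \<Rightarrow> 'a \<Rightarrow> 'b" where
  "iter_diff [] f x = f x"
| "iter_diff (a # as) f x = iter_diff as f (x + a) - iter_diff as f x"

lemma iter_diff_mem:
  assumes "\<And>x. f x \<in> C" and "\<And>u v. u \<in> C \<Longrightarrow> v \<in> C \<Longrightarrow> u - v \<in> C"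
  shows "iter_diff as f x \<in> C"
  using assms by (induction as arbitrary: x) auto

lemma iter_diff_add: "iter_diff as (\<lambda>x. f x + g x) x = iter_diff as f x + iter_diff as g x"
  by (induction as arbitrary: x) auto

lemma iter_diff_diff: "iter_diff as (\<lambda>x. f x - g x) x = iter_diff as f x - iter_diff as g x"
  by (induction as arbitrary: x) auto

lemma iter_diff_zero: "(\<And>x. f x = 0) \<Longrightarrow> iter_diff as f x = 0"
  by (induction as arbitrary: x) auto

lemma iter_diff_affine:
  assumes "\<And>x a. h (x + a) = h x + l a"
  shows "iter_diff as (\<lambda>x. f (h x)) x = iter_diff (map l as) f (h x)"
  by (induction as arbitrary: x) (auto simp: assms)

lemma iter_diff_append: "iter_diff (as @ bs) f x = iter_diff as (iter_diff bs f) x"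
  by (induction as arbitrary: x) auto

lemma iter_diff_step: "iter_diff (a # as) f x = iter_diff as (\<lambda>x. f (x + a) - f x) x"
proof -
  have "iter_diff as (\<lambda>x. f (x + a)) x = iter_diff (map id as) f (x + a)"
    by (rule iter_diff_affine) (simp add: algebra_simps)
  then show ?thesis
    by (simp add: iter_diff_diff)
qed

text \<open>Degree modulo \<open>p\<close> is measured by iterated differences, not by representing polynomials.\<close>

definition degree_less :: "nat \<Rightarrow> nat \<Rightarrow> ('a::ab_group_add \<Rightarrow> int) \<Rightarrow> bool" where
  "degree_less p D f \<longleftrightarrow> (\<forall>as x. length as = D \<longrightarrow> int p dvd iter_diff as f x)"

lemma iter_diff_dvd: "(\<And>x. int p dvd f x) \<Longrightarrow> int p dvd iter_diff as f x"
  by (induction as arbitrary: x) auto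

lemma degree_less_mono:
  assumes "degree_less p D f" and "D \<le> E"
  shows "degree_less p E f"
  unfolding degree_less_def
proof (intro allI impI)
  fix as x assume "length (as :: 'a list) = E"
  define bs where "bs = drop (E - D) as"
  have "length bs = D"
    using \<open>length as = E\<close> \<open>D \<le> E\<close> by (simp add: bs_def)
  then have "int p dvd iter_diff (take (E - D) as) (iter_diff bs f) x"
    using assms(1) unfolding degree_less_def
    by (intro iter_diff_dvd[where f = "iter_diff bs f"]) blast
  then show "int p dvd iter_diff as f x"
    by (simp add: bs_def flip: iter_diff_append)
qed

lemma degree_less_cong:
  assumes "degree_less p D f" and "\<And>x. [f x = g x] (mod int p)"
  shows "degree_less p D g"
  unfolding degree_less_def
proof (intro allI impI)
  fix as x assume "length (as :: 'a list) = D"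
  then have "int p dvd iter_diff as f x"
    using assms(1) by (auto simp: degree_less_def)
  moreover have "int p dvd iter_diff as (\<lambda>x. f x - g x) x"
    using assms(2) by (intro iter_diff_dvd) (auto simp: cong_iff_dvd_diff)
  ultimately show "int p dvd iter_diff as g x"
    by (simp add: iter_diff_diff dvd_diff_right_iff)
qed

lemma degree_less_add:
  assumes "degree_less p D f" "degree_less p D g"
  shows "degree_less p D (\<lambda>x. f x + g x)"
  using assms by (auto simp: degree_less_def iter_diff_add)

lemma degree_less_diff:
  assumes "degree_less p D f" "degree_less p D g"
  shows "degree_less p D (\<lambda>x. f x - g x)"
  using assms by (auto simp: degree_less_def iter_diff_diff)

lemma degree_less_const: "degree_less p (Suc 0) (\<lambda>_. c)"
  by (auto simp: degree_less_def length_Suc_conv)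

lemma degree_less_zero: "degree_less p D (\<lambda>_. 0)"
  by (auto simp: degree_less_def iter_diff_zero)

lemma degree_less_sum:
  "(\<And>i. i \<in> I \<Longrightarrow> degree_less p D (f i)) \<Longrightarrow> degree_less p D (\<lambda>x. \<Sum>i\<in>I. f i x)"
  by (induction I rule: infinite_finite_induct)
     (auto intro: degree_less_add degree_less_zero)

lemma degree_less_Suc:
  "degree_less p (Suc D) f \<longleftrightarrow> (\<forall>a. degree_less p D (\<lambda>x. f (x + a) - f x))"
proof -
  have "degree_less p (Suc D) f \<longleftrightarrow> (\<forall>a as x. length as = D \<longrightarrow> int p dvd iter_diff (a # as) f x)"
    unfolding degree_less_def length_Suc_conv by blast
  then show ?thesis
    unfolding iter_diff_step degree_less_def .
qed

text \<open>The product rule writes a first difference of fg as a sum of three products, each with a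
  smaller total bound. For positive \<open>D\<close> and \<open>E\<close> the result is one above
  the sharp bound; only boundedness matters later.\<close>

lemma degree_less_mult:
  assumes "degree_less p D f" "degree_less p E g"
  shows "degree_less p (D + E) (\<lambda>x. f x * g x)"
  using assms
proof (induction "D + E" arbitrary: D E f g)
  case 0
  then show ?case by (simp add: degree_less_def)
next
  case (Suc n)
  show ?case
  proof (cases "D = 0 \<or> E = 0")
    case True
    then have "int p dvd f x * g x" for x
      using Suc.prems by (auto simp: degree_less_def)
    then show ?thesis
      by (auto simp: degree_less_def intro: iter_diff_dvd)
  next
    case False
    then obtain D' E' where DE: "D = Suc D'" "E = Suc E'"
      by (metis not0_implies_Suc)
    have "degree_less p (D' + E) (\<lambda>x. (f (x + a) - f x) * g x)"
      and "degree_less p (D + E') (\<lambda>x. f x * (g (x + a) - g x))"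
      and "degree_less p (D' + E) (\<lambda>x. (f (x + a) - f x) * (g (x + a) - g x))" for a
      using Suc.prems Suc.hyps(2) DE degree_less_mono[of p E' _ E]
      by (intro Suc.hyps(1); auto simp: degree_less_Suc)+
    moreover have "D + E' = D' + E"
      using DE by simp
    ultimately have "degree_less p (D' + E) (\<lambda>x. (f (x + a) - f x) * g x + f x * (g (x + a) - g x)
        + (f (x + a) - f x) * (g (x + a) - g x))" for a
      by (intro degree_less_add) simp_all
    moreover have "(f (x + a) - f x) * g x + f x * (g (x + a) - g x) + (f (x + a) - f x) * (g (x + a) - g x)
        = f (x + a) * g (x + a) - f x * g x" for x a
      by (simp add: algebra_simps)
    ultimately have "degree_less p (D' + E) (\<lambda>x. f (x + a) * g (x + a) - f x * g x)" for a
      by simp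
    then have "degree_less p (Suc (D' + E)) (\<lambda>x. f x * g x)"
      by (simp add: degree_less_Suc)
    then show ?thesis
      using DE by simp
  qed
qed

text \<open>The \<open>Suc\<close> accounts for the empty product, a nonzero constant.\<close>

lemma degree_less_prod:
  assumes "finite I" and "\<And>i. i \<in> I \<Longrightarrow> degree_less p (D i) (f i)"
  shows "degree_less p (Suc (\<Sum>i\<in>I. D i)) (\<lambda>x. \<Prod>i\<in>I. f i x)"
  using assms
proof (induction I rule: finite_induct)
  case empty
  then show ?case by (simp add: degree_less_const)
next
  case (insert i I)
  then have "degree_less p (D i + Suc (\<Sum>i\<in>I. D i)) (\<lambda>x. f i x * (\<Prod>i\<in>I. f i x))"
    by (intro degree_less_mult) auto
  then show ?case
    using insert by simp
qed

lemma degree_less_power: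
  assumes "degree_less p D f"
  shows "degree_less p (Suc (k * D)) (\<lambda>x. f x ^ k)"
  using degree_less_prod[of "{..<k}" p "\<lambda>_. D" "\<lambda>_. f"] assms by simp

section \<open>Indicator functions on finite elementary abelian p-groups\<close>

definition additive_mod :: "nat \<Rightarrow> 'a::ab_group_add set \<Rightarrow> ('a \<Rightarrow> int) \<Rightarrow> bool" where
  "additive_mod p C l \<longleftrightarrow> (\<forall>x\<in>C. \<forall>y\<in>C. [l (x + y) = l x + l y] (mod int p))"

text \<open>An embedding of \<open>C\<close> into a power of Z/p. The coordinates are kept as
  integer-valued functions, so that degrees are computed in \<open>int\<close> up to congruence;
  this stands in for a vector space structure on \<open>C\<close>.\<close>

definition coordinate_system :: "nat \<Rightarrow> 'a::ab_group_add set \<Rightarrow> ('a \<Rightarrow> int) set \<Rightarrow> bool" where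
  "coordinate_system p C L \<longleftrightarrow> finite L \<and> (\<forall>l\<in>L. additive_mod p C l) \<and>
     (\<forall>x\<in>C. \<forall>y\<in>C. (\<forall>l\<in>L. [l x = l y] (mod int p)) \<longrightarrow> x = y)"

lemma coordinate_system_subset:
  "coordinate_system p C L \<Longrightarrow> C' \<subseteq> C \<Longrightarrow> coordinate_system p C' L"
  unfolding coordinate_system_def additive_mod_def by (meson subsetD)

lemma additive_mod_diff:
  assumes "additive_mod p C l" "x \<in> C" "y \<in> C" "x - y \<in> C"
  shows "[l (x - y) = l x - l y] (mod int p)"
proof -
  have "[l (x - y + y) = l (x - y) + l y] (mod int p)"
    using assms unfolding additive_mod_def by blast
  from cong_diff[OF this cong_refl[of "l y"]] show ?thesis
    by (simp add: cong_sym_eq)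
qed

text \<open>Modulo p, an additive coordinate commutes with taking differences, so the D-fold
  differences of the coordinate of \<open>g\<close> are congruent to \<open>l 0\<close>, that is, to
  0.\<close>

lemma degree_less_coordinate:
  fixes g :: "'a::ab_group_add \<Rightarrow> 'b::ab_group_add"
  assumes l: "additive_mod p C l" and g: "\<And>x. g x \<in> C"
    and C: "\<And>u v. u \<in> C \<Longrightarrow> v \<in> C \<Longrightarrow> u - v \<in> C"
    and D: "\<And>as x. length as = D \<Longrightarrow> iter_diff as g x = 0"
  shows "degree_less p D (\<lambda>x. l (g x))"
proof -
  have *: "[l (iter_diff as g x) = iter_diff as (\<lambda>x. l (g x)) x] (mod int p)" for as x
  proof (induction as arbitrary: x)
    case (Cons a as)
    have "[l (iter_diff as g (x + a) - iter_diff as g x) = l (iter_diff as g (x + a)) - l (iter_diff as g x)] (mod int p)"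
      by (intro additive_mod_diff[OF l] iter_diff_mem C g)
    then show ?case
      unfolding iter_diff.simps by (rule cong_trans) (intro cong_diff Cons.IH)
  qed auto
  have "0 \<in> C"
    using C[OF g g, of undefined undefined] by simp
  then have l0: "[l 0 = 0] (mod int p)"
    using additive_mod_diff[OF l, of 0 0] by (simp add: cong_def)
  show ?thesis
    unfolding degree_less_def
  proof (intro allI impI)
    fix as x assume "length (as :: 'a list) = D"
    then show "int p dvd iter_diff as (\<lambda>x. l (g x)) x"
      using *[of as x] l0 D[of as x] by (simp add: cong_def dvd_eq_mod_eq_0)
  qed
qed

lemma fermat_indicator:
  fixes a :: int
  assumes "prime p"
  shows "[1 - a ^ (p - 1) = of_bool (int p dvd a)] (mod int p)"
proof (cases "int p dvd a")
  case True
  then have "int p dvd a ^ (p - 1)"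
    using prime_gt_1_nat[OF assms] by (intro dvd_trans[OF True dvd_power]) auto
  then show ?thesis
    using True by (simp add: cong_iff_dvd_diff)
next
  case False
  define b where "b = nat (a mod int p)"
  have b: "[a = int b] (mod int p)"
    using prime_gt_0_nat[OF assms] by (simp add: b_def cong_def)
  then have "\<not> p dvd b"
    using False by (metis cong_dvd_iff int_dvd_int_iff cong_sym)
  then have "[b ^ (p - 1) = 1] (mod p)"
    using assms by (intro fermat_theorem) auto
  then have "[int b ^ (p - 1) = 1] (mod int p)"
    by (metis cong_int_iff of_nat_1 of_nat_power)
  then have "[a ^ (p - 1) = 1] (mod int p)"
    using cong_pow[OF b] cong_trans by blast
  then show ?thesis
    using False by (simp add: cong_iff_dvd_diff dvd_diff_commute)
qed

text \<open>
  By Fermat, the indicator of a point is the product of the functions \<open>1 - (l x - l y) ^ (p - 1)\<close>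
  over the coordinates \<open>l\<close>. The bound does not depend on \<open>g\<close>.
\<close>

lemma indicator_degree_bound:
  fixes C :: "'b::ab_group_add set"
  assumes p: "prime p" and L: "coordinate_system p C L" and "finite C"
    and C: "\<And>u v. u \<in> C \<Longrightarrow> v \<in> C \<Longrightarrow> u - v \<in> C"
  obtains E where "\<And>(g :: 'a::ab_group_add \<Rightarrow> 'b) Z. (\<And>x. g x \<in> C) \<Longrightarrow>
    (\<And>as x. length as = D \<Longrightarrow> iter_diff as g x = 0) \<Longrightarrow> Z \<subseteq> C \<Longrightarrow>
    degree_less p E (\<lambda>x. of_bool (g x \<in> Z))"
proof -
  \<comment> \<open>\<open>Suc D\<close> bounds \<open>l (g x) - l y\<close>, because the constant
    \<open>l y\<close> costs 1 even if \<open>D = 0\<close>; \<open>degree_less_power\<close> with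
    exponent \<open>p - 1\<close> then gives \<open>N\<close>.\<close>
  define N where "N = Suc ((p - 1) * Suc D)"
  have fin: "finite L" and sep: "\<And>x y. x \<in> C \<Longrightarrow> y \<in> C \<Longrightarrow> (\<forall>l\<in>L. [l x = l y] (mod int p)) \<Longrightarrow> x = y"
    using L by (auto simp: coordinate_system_def)
  have "degree_less p (Suc (\<Sum>l\<in>L. N)) (\<lambda>x. of_bool (g x \<in> Z))"
    if g: "\<And>x. g x \<in> C" and D: "\<And>as x. length as = D \<Longrightarrow> iter_diff as g x = 0" and Z: "Z \<subseteq> C"
    for g :: "'a \<Rightarrow> 'b" and Z
  proof -
    define t where "t y x = (\<Prod>l\<in>L. 1 - (l (g x) - l y) ^ (p - 1))" for y x
    have "degree_less p (Suc (\<Sum>l\<in>L. N)) (t y)" for y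
      unfolding t_def
    proof (intro degree_less_prod fin)
      fix l assume "l \<in> L"
      then have "degree_less p D (\<lambda>x. l (g x))"
        using L by (intro degree_less_coordinate[OF _ g C D]) (auto simp: coordinate_system_def)
      then have "degree_less p (Suc D) (\<lambda>x. l (g x) - l y)"
        by (intro degree_less_diff) (auto intro: degree_less_mono degree_less_const)
      then have "degree_less p N (\<lambda>x. (l (g x) - l y) ^ (p - 1))"
        unfolding N_def by (rule degree_less_power)
      then show "degree_less p N (\<lambda>x. 1 - (l (g x) - l y) ^ (p - 1))"
        by (intro degree_less_diff) (auto simp: N_def intro: degree_less_mono degree_less_const)
    qed
    then have "degree_less p (Suc (\<Sum>l\<in>L. N)) (\<lambda>x. \<Sum>y\<in>Z. t y x)"
      by (rule degree_less_sum)
    moreover have "[(\<Sum>y\<in>Z. t y x) = of_bool (g x \<in> Z)] (mod int p)" for x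
    proof -
      have "[t y x = of_bool (y = g x)] (mod int p)" if "y \<in> Z" for y
      proof -
        have "[t y x = (\<Prod>l\<in>L. of_bool (int p dvd l (g x) - l y))] (mod int p)"
          unfolding t_def by (intro cong_prod fermat_indicator p)
        also have "(\<Prod>l\<in>L. of_bool (int p dvd l (g x) - l y)) =
            (of_bool (\<forall>l\<in>L. int p dvd l (g x) - l y) :: int)"
          using fin by (induction L rule: finite_induct) auto
        also have "(\<forall>l\<in>L. int p dvd l (g x) - l y) \<longleftrightarrow> y = g x"
          using sep[of "g x" y] g Z that by (auto simp: cong_iff_dvd_diff)
        finally show ?thesis .
      qed
      then have "[(\<Sum>y\<in>Z. t y x) = (\<Sum>y\<in>Z. of_bool (y = g x))] (mod int p)"
        by (intro cong_sum)
      moreover have "finite Z"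
        using Z \<open>finite C\<close> finite_subset by blast
      ultimately show ?thesis
        by (simp add: of_bool_def sum.delta)
    qed
    ultimately show ?thesis
      by (rule degree_less_cong)
  qed
  then show thesis
    using that by blast
qed

section \<open>Sequences given by polynomials\<close>

definition polynomial_sequence :: "(nat \<Rightarrow> nat) \<Rightarrow> bool" where
  "polynomial_sequence f \<longleftrightarrow> (\<exists>A :: rat poly. \<forall>n. poly A (of_nat n) = of_nat (f n))"

lemma polynomial_sequence_const: "polynomial_sequence (\<lambda>_. c)"
  unfolding polynomial_sequence_def by (rule exI[of _ "[:of_nat c:]"]) simp

lemma polynomial_sequence_add:
  assumes "polynomial_sequence f" "polynomial_sequence g"
  shows "polynomial_sequence (\<lambda>n. f n + g n)"
proof -
  obtain A B :: "rat poly" where "\<And>n. poly A (of_nat n) = of_nat (f n)" "\<And>n. poly B (of_nat n) = of_nat (g n)"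
    using assms by (auto simp: polynomial_sequence_def)
  then have "poly (A + B) (of_nat n) = of_nat (f n + g n)" for n
    by simp
  then show ?thesis
    unfolding polynomial_sequence_def by blast
qed

lemma polynomial_sequence_shift:
  assumes "polynomial_sequence f"
  shows "polynomial_sequence (\<lambda>n. f (m + n))"
proof -
  obtain A :: "rat poly" where A: "\<And>n. poly A (of_nat n) = of_nat (f n)"
    using assms by (auto simp: polynomial_sequence_def)
  have "poly (pcompose A [:of_nat m, 1:]) (of_nat n) = of_nat (f (m + n))" for n
    using A[of "m + n"] by (simp add: poly_pcompose)
  then show ?thesis
    unfolding polynomial_sequence_def by blast
qed

lemma poly_gbinomial: "\<exists>B :: rat poly. \<forall>x. poly B x = x gchoose k"
proof (intro exI allI)
  fix x :: rat
  show "poly (Polynomial.smult (1 / fact k) (\<Prod>i<k. [:- of_nat i, 1:])) x = x gchoose k"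
    by (simp add: gbinomial_prod_rev poly_prod atLeast0LessThan)
qed

text \<open>
  The induction needs the factor \<open>n choose k\<close>, because
  \<open>n (n choose k) = (k + 1) (n choose (k + 1)) + k (n choose k)\<close>.
\<close>

lemma sum_choose_mult_poly:
  "\<exists>R :: rat poly. \<forall>n. poly R (of_nat n) = (\<Sum>j<n. of_nat (j choose k) * poly Q (of_nat j))"
proof (induction Q arbitrary: k)
  case 0
  show ?case by (rule exI[of _ 0]) simp
next
  case (pCons a Q)
  obtain B :: "rat poly" where B: "\<And>x. poly B x = x gchoose Suc k"
    using poly_gbinomial[of "Suc k"] by blast
  have B': "poly B (of_nat n) = (\<Sum>j<n. of_nat (j choose k))" for n
  proof -
    have "n choose Suc k = (\<Sum>j<n. j choose k)"
      by (induction n) simp_all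
    then show ?thesis
      by (simp add: B flip: binomial_gbinomial)
  qed
  obtain R1 R2 :: "rat poly"
    where R1: "\<And>n. poly R1 (of_nat n) = (\<Sum>j<n. of_nat (j choose Suc k) * poly Q (of_nat j))"
      and R2: "\<And>n. poly R2 (of_nat n) = (\<Sum>j<n. of_nat (j choose k) * poly Q (of_nat j))"
    using pCons.IH[of "Suc k"] pCons.IH[of k] by blast
  have "rat_of_nat j * of_nat (j choose k) = of_nat (Suc k) * of_nat (j choose Suc k) + of_nat k * of_nat (j choose k)" for j
  proof -
    have "j * (j choose k) = Suc k * (j choose Suc k) + k * (j choose k)"
      using Suc_times_binomial_eq[of j k] by (simp add: algebra_simps)
    then show ?thesis
      by (simp only: flip: of_nat_mult of_nat_add)
  qed
  moreover have "rat_of_nat (j choose k) * poly (pCons a Q) (of_nat j) =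
     a * of_nat (j choose k) + (of_nat j * of_nat (j choose k)) * poly Q (of_nat j)" for j
    by (simp add: algebra_simps)
  ultimately have "rat_of_nat (j choose k) * poly (pCons a Q) (of_nat j) =
     a * of_nat (j choose k) + (of_nat (Suc k) * (of_nat (j choose Suc k) * poly Q (of_nat j))
       + of_nat k * (of_nat (j choose k) * poly Q (of_nat j)))" for j
    by (simp only: distrib_right mult.assoc)
  then have "poly (Polynomial.smult a B + (Polynomial.smult (of_nat (Suc k)) R1 + Polynomial.smult (of_nat k) R2)) (of_nat n) =
      (\<Sum>j<n. of_nat (j choose k) * poly (pCons a Q) (of_nat j))" for n
    by (simp add: B' R1 R2 sum.distrib sum_distrib_left del: of_nat_Suc)
  then show ?case by blast
qed

text \<open>Summation with \<open>k = 0\<close>, where the binomial factor is 1: \<open>f n\<close>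
  is \<open>f 0\<close> plus a sum of values of a polynomial.\<close>

lemma polynomial_sequence_of_differences:
  assumes "polynomial_sequence g" and "\<And>n. f (Suc n) = g n + f n"
  shows "polynomial_sequence f"
proof -
  obtain A R :: "rat poly" where A: "\<And>n. poly A (of_nat n) = of_nat (g n)"
    and R: "\<And>n. poly R (of_nat n) = (\<Sum>j<n. of_nat (j choose 0) * poly A (of_nat j))"
    using assms(1) sum_choose_mult_poly[of 0] unfolding polynomial_sequence_def by blast
  have "poly ([:of_nat (f 0):] + R) (of_nat n) = of_nat (f n)" for n
  proof (induction n)
    case (Suc n)
    then show ?case
      using assms(2)[of n] R[of n] R[of "Suc n"] A[of n] by simp
  qed (use R[of 0] in simp)
  then show ?thesis
    unfolding polynomial_sequence_def by blast
qed

section \<open>Counting\<close>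

lemma card_equal_fibres:
  assumes "finite A" and "\<And>y. y \<in> f ` A \<Longrightarrow> card {x \<in> A. f x = y} = c"
  shows "card A = card (f ` A) * c"
proof -
  have "card A = (\<Sum>y\<in>f ` A. card {x \<in> A. f x = y})"
    using sum.image_gen[OF assms(1), of "\<lambda>_. 1::nat" f] by simp
  then show ?thesis
    using assms(2) by simp
qed

lemma card_coset:
  fixes C :: "'a::ab_group_add set"
  assumes "x \<in> C" and C: "\<And>u v. u \<in> C \<Longrightarrow> v \<in> C \<Longrightarrow> u - v \<in> C" 
    and ker: "\<And>y. y \<in> C \<Longrightarrow> f y = f x \<longleftrightarrow> y - x \<in> K" and "K \<subseteq> C"
  shows "card {y \<in> C. f y = f x} = card K"
proof -
  have "bij_betw (\<lambda>y. y - x) {y \<in> C. f y = f x} K"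
  proof (rule bij_betw_byWitness[where f' = "\<lambda>k. k + x"])
    have "k + x \<in> C" if "k \<in> K" for k
      \<comment> \<open>Closure under differences yields sums: k + x = k - (x - x - x).\<close>
      using C[of k "x - x - x"] C[of x x] C[of "x - x" x] that assms by auto
    then show "(\<lambda>k. k + x) ` K \<subseteq> {y \<in> C. f y = f x}"
      using ker by auto
  qed (use ker in auto)
  then show ?thesis
    by (rule bij_betw_same_card)
qed

text \<open>Primality makes any nonzero a in \<open>V\<close> invertible modulo p, so its multiples,
  which are repeated sums, already exhaust all residues. This is the reason why subgroups are
  subspaces over a prime field.\<close>

lemma residues_additively_closed:
  fixes V :: "int set"
  assumes p: "prime p" and "V \<subseteq> {0..<int p}" and "0 \<in> V" and "V \<noteq> {0}"
    and add: "\<And>u v. u \<in> V \<Longrightarrow> v \<in> V \<Longrightarrow> (u + v) mod int p \<in> V"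
  shows "V = {0..<int p}"
proof
  obtain a where a: "a \<in> V" "a \<noteq> 0"
    using assms by blast
  then have a': "0 < a" "a < int p"
    using assms(2) by force+
  then have "coprime a (int p)"
    using p by (metis coprime_commute prime_imp_coprime prime_int_nat_transfer zdvd_not_zless prime_nat_int_transfer)
  have mult: "(int k * a) mod int p \<in> V" for k
  proof (induction k)
    case (Suc k)
    have "(a + (int k * a) mod int p) mod int p \<in> V"
      using add[OF a(1) Suc] .
    then show ?case
      by (simp add: algebra_simps mod_add_right_eq)
  qed (use \<open>0 \<in> V\<close> in simp)
  show "{0..<int p} \<subseteq> V"
  proof
    fix v assume v: "v \<in> {0..<int p}"
    obtain b where b: "[a * b = 1] (mod int p)"
      using cong_solve_coprime_int[OF \<open>coprime a (int p)\<close>] by blast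
    define k where "k = nat ((b * v) mod int p)"
    have "int k = (b * v) mod int p"
      using prime_gt_0_nat[OF p] by (simp add: k_def)
    then have "[int k * a = b * v * a] (mod int p)"
      by (intro cong_mult) (simp_all add: cong_def)
    also have "[b * v * a = 1 * v] (mod int p)"
      using cong_scalar_right[OF b, of v] by (simp add: ac_simps)
    finally have "(int k * a) mod int p = v"
      using v by (simp add: cong_def)
    then show "v \<in> V"
      using mult[of k] by simp
  qed
qed (use assms in auto)

text \<open>Remove one coordinate l at a time. On the kernel of l modulo p the remaining coordinates
  still separate points, and the image of l is either zero or all of Z/p, so the cardinality of the
  kernel is multiplied by 1 or by p.\<close>

lemma card_coordinate_system:
  assumes p: "prime p" and L: "coordinate_system p C L" and "finite C" and "C \<noteq> {}"
    and C: "\<And>u v. u \<in> C \<Longrightarrow> v \<in> C \<Longrightarrow> u - v \<in> C"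
  shows "\<exists>k. card C = p ^ k"
proof -
  have "finite L"
    using L by (simp add: coordinate_system_def)
  then show ?thesis
    using L \<open>finite C\<close> \<open>C \<noteq> {}\<close> C
  proof (induction L arbitrary: C rule: finite_induct)
    case empty
    then obtain x where "x \<in> C"
      by blast
    moreover have "y = x" if "y \<in> C" for y
      using empty(1) that \<open>x \<in> C\<close> by (simp add: coordinate_system_def)
    ultimately have "C = {x}"
      by blast
    then have "card C = p ^ 0"
      by simp
    then show ?case ..
  next
    case (insert l L)
    define f where "f x = l x mod int p" for x
    define K where "K = {x \<in> C. f x = 0}"
    note C = insert.prems(4)
    have l: "additive_mod p C l"
      using insert.prems by (simp add: coordinate_system_def)
    have "0 \<in> C"
      using insert.prems(3) C by fastforce
    have add: "u + v \<in> C" if "u \<in> C" "v \<in> C" for u v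
      using C[OF that(1) C[OF \<open>0 \<in> C\<close> that(2)]] by simp
    have f_diff: "f (u - v) = (f u - f v) mod int p" if "u \<in> C" "v \<in> C" for u v
      using additive_mod_diff[OF l that C[OF that]] by (simp add: f_def cong_def mod_diff_eq)
    have f_add: "f (u + v) = (f u + f v) mod int p" if "u \<in> C" "v \<in> C" for u v
      using l that by (simp add: f_def cong_def mod_add_eq additive_mod_def)
    have f_range: "f x \<in> {0..<int p}" for x
      using prime_gt_0_nat[OF p] by (simp add: f_def)
    have "f 0 = 0"
      using f_diff[OF \<open>0 \<in> C\<close> \<open>0 \<in> C\<close>] by simp
    have "coordinate_system p K (insert l L)"
      using insert.prems(1) by (rule coordinate_system_subset) (auto simp: K_def)
    then have "coordinate_system p K L"
      by (auto simp: coordinate_system_def K_def f_def cong_def)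
    moreover have "u - v \<in> K" if "u \<in> K" "v \<in> K" for u v
      using that C f_diff by (auto simp: K_def)
    moreover have "0 \<in> K"
      using \<open>0 \<in> C\<close> \<open>f 0 = 0\<close> by (simp add: K_def)
    moreover have "finite K"
      using \<open>finite C\<close> by (simp add: K_def)
    ultimately obtain k where k: "card K = p ^ k"
      using insert.IH by blast
    have "card C = card (f ` C) * p ^ k"
    proof (rule card_equal_fibres[OF \<open>finite C\<close>])
      fix y assume "y \<in> f ` C"
      then obtain x where x: "x \<in> C" "y = f x"
        by blast
      have "f y = f x \<longleftrightarrow> y - x \<in> K" if "y \<in> C" for y
      proof -
        have "f y = f x \<longleftrightarrow> (f y - f x) mod int p = 0"
          by (simp add: f_def mod_diff_eq mod_eq_dvd_iff dvd_eq_mod_eq_0)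
        then show ?thesis
          using that x by (simp add: K_def f_diff C)
      qed
      then show "card {x \<in> C. f x = y} = p ^ k"
        unfolding x(2) k[symmetric] by (intro card_coset C x) (auto simp: K_def)
    qed
    moreover have "f ` C = {0} \<or> f ` C = {0..<int p}"
    proof -
      have "(u + v) mod int p \<in> f ` C" if "u \<in> f ` C" "v \<in> f ` C" for u v
        using that add by (auto simp: image_iff simp flip: f_add)
      moreover have "0 \<in> f ` C"
        using \<open>0 \<in> C\<close> \<open>f 0 = 0\<close> image_eqI[of 0 f 0 C] by simp
      ultimately show ?thesis
        using residues_additively_closed[OF p, of "f ` C"] f_range by blast
    qed
    ultimately have "card C = p ^ k \<or> card C = p ^ Suc k"
      by auto
    then show ?case by blast
  qed
qed

section \<open>Functors on integer matrices\<close>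

type_synonym int_matrix = "nat \<Rightarrow> nat \<Rightarrow> int"

text \<open>
  Matrices carry no dimensions. Thus \<open>unit_matrix\<close>, taken with \<open>m\<close> rows and \<open>m + n\<close> columns,
  is the projection of \<open>K\<^bsup>m+n\<^esup>\<close> to \<open>K\<^sup>m\<close>; with \<open>m + n\<close> rows and \<open>m\<close> columns it is the inclusion.
\<close>

definition unit_matrix :: int_matrix where
  "unit_matrix i j = of_bool (i = j)"

definition matrix_prod :: "nat \<Rightarrow> int_matrix \<Rightarrow> int_matrix \<Rightarrow> int_matrix" where
  "matrix_prod k A B i j = (\<Sum>l<k. A i l * B l j)"

text \<open>On K^(m+n), regarded as K^m + K^n: \<open>shift_rows m A\<close> is A followed by the
  inclusion of the second summand, and \<open>shift_cols m A\<close> is the projection to the second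
  summand followed by A.\<close>

definition shift_rows :: "nat \<Rightarrow> int_matrix \<Rightarrow> int_matrix" where
  "shift_rows m A i j = (if i < m then 0 else A (i - m) j)"

definition shift_cols :: "nat \<Rightarrow> int_matrix \<Rightarrow> int_matrix" where
  "shift_cols m A i j = (if j < m then 0 else A i (j - m))"

text \<open>The map sending y to the pair of its first m coordinates and A y. In particular
  \<open>unit_block m A\<close> is the direct sum of the identity of K^m and A.\<close>

definition unit_above :: "nat \<Rightarrow> int_matrix \<Rightarrow> int_matrix" where
  "unit_above m A i j = (if i < m then unit_matrix i j else A (i - m) j)"

abbreviation unit_block :: "nat \<Rightarrow> int_matrix \<Rightarrow> int_matrix" where
  "unit_block m A \<equiv> unit_above m (shift_cols m A)"

lemma matrix_prod_unit_left: "i < k \<Longrightarrow> matrix_prod k unit_matrix B i j = B i j"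
  by (simp add: matrix_prod_def unit_matrix_def of_bool_def if_distrib[of "\<lambda>x. x * _"] sum.delta' cong: if_cong)

lemma matrix_prod_unit_right: "matrix_prod k A unit_matrix i j = (if j < k then A i j else 0)"
  by (simp add: matrix_prod_def unit_matrix_def of_bool_def if_distrib[of "\<lambda>x. _ * x"] sum.delta cong: if_cong)

lemma sum_lessThan_shift:
  fixes m v :: nat
  assumes "\<And>l. l < m \<Longrightarrow> f l = 0"
  shows "(\<Sum>l<m + v. f l) = (\<Sum>l<v. f (m + l))"
proof -
  have "(\<Sum>l<m + v. f l) = (\<Sum>l=m..<m + v. f l)"
    by (rule sum.mono_neutral_right) (use assms in auto)
  also have "\<dots> = (\<Sum>l<v. f (m + l))"
    using sum.shift_bounds_nat_ivl[of f 0 m v] by (simp add: atLeast0LessThan add.commute)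
  finally show ?thesis .
qed

lemma matrix_prod_shift_rows_right:
  "matrix_prod (m + v) A (shift_rows m B) = matrix_prod v (\<lambda>i j. A i (m + j)) B"
  by (simp add: fun_eq_iff matrix_prod_def shift_rows_def sum_lessThan_shift)

lemma matrix_prod_shift_rows: "matrix_prod k (shift_rows m A) B = shift_rows m (matrix_prod k A B)"
  by (simp add: fun_eq_iff matrix_prod_def shift_rows_def)

lemma matrix_prod_shift_cols: "matrix_prod k A (shift_cols m B) = shift_cols m (matrix_prod k A B)"
  by (simp add: fun_eq_iff matrix_prod_def shift_cols_def)

lemma matrix_prod_shift_cols_left:
  "matrix_prod (m + v) (shift_cols m A) B = matrix_prod v A (\<lambda>i j. B (m + i) j)"
  by (simp add: fun_eq_iff matrix_prod_def shift_cols_def sum_lessThan_shift)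

lemma matrix_prod_unit_above:
  "i < m + n \<Longrightarrow> m \<le> k \<Longrightarrow>
    matrix_prod k (unit_above m A) B i j = (if i < m then B i j else matrix_prod k A B (i - m) j)"
  using matrix_prod_unit_left[of i k B j] by (auto simp: unit_above_def matrix_prod_def)

lemma matrix_prod_unit_block:
  "i < m + n \<Longrightarrow> matrix_prod (m + k) (unit_block m A) (unit_block m B) i j
    = unit_block m (matrix_prod k A B) i j"
  by (subst matrix_prod_unit_above[where n = n])
     (auto simp: matrix_prod_shift_cols_left unit_above_def unit_matrix_def shift_cols_def matrix_prod_def)

text \<open>
  \<open>C n\<close> is the value at \<open>K\<^sup>n\<close>, and \<open>F m n A\<close> is the action of a matrix with \<open>n\<close> rows and \<open>m\<close>
  columns. The last assumption says that the functor has degree less than \<open>D\<close>.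
\<close>

locale matrix_functor =
  fixes p D :: nat
    and C :: "nat \<Rightarrow> 'g::ab_group_add set"
    and F :: "nat \<Rightarrow> nat \<Rightarrow> int_matrix \<Rightarrow> 'g \<Rightarrow> 'g"
  assumes prime: "prime p"
    and zero_mem: "0 \<in> C n"
    and diff_mem: "x \<in> C n \<Longrightarrow> y \<in> C n \<Longrightarrow> x - y \<in> C n"
    and finite: "finite (C n)"
    and coordinates: "\<exists>L. coordinate_system p (C n) L"
    and closed: "x \<in> C m \<Longrightarrow> F m n A x \<in> C n"
    and add: "x \<in> C m \<Longrightarrow> y \<in> C m \<Longrightarrow> F m n A (x + y) = F m n A x + F m n A y"
    and cong: "x \<in> C m \<Longrightarrow> (\<And>i j. i < n \<Longrightarrow> j < m \<Longrightarrow> A i j = B i j) \<Longrightarrow> F m n A x = F m n B x"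
    and comp: "x \<in> C k \<Longrightarrow> F m n A (F k m B x) = F k n (matrix_prod m A B) x"
    and unit: "x \<in> C n \<Longrightarrow> F n n unit_matrix x = x"
    and degree: "x \<in> C m \<Longrightarrow> length as = D \<Longrightarrow> iter_diff as (\<lambda>A. F m n A x) B = 0"
begin

lemma add_mem: "x \<in> C n \<Longrightarrow> y \<in> C n \<Longrightarrow> x + y \<in> C n"
  using diff_mem[of x n "0 - y"] diff_mem[of 0 n y] zero_mem by simp

lemma diff:
  assumes "x \<in> C m" "y \<in> C m"
  shows "F m n A (x - y) = F m n A x - F m n A y"
  using add[OF diff_mem[OF assms] assms(2), of n A] by (simp add: algebra_simps)

lemma zero: "F m n A 0 = 0"
  using diff[OF zero_mem zero_mem] by simp

lemma comp_eq:
  assumes "x \<in> C k" and "\<And>i j. i < n \<Longrightarrow> j < k \<Longrightarrow> matrix_prod m A B i j = E i j"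
  shows "F m n A (F k m B x) = F k n E x"
  using comp[OF assms(1), of m n A B] cong[OF assms(1,2), of n] by simp

lemma unit_eq:
  assumes "x \<in> C n" and "\<And>i j. i < n \<Longrightarrow> j < n \<Longrightarrow> A i j = unit_matrix i j"
  shows "F n n A x = x"
  using unit[OF assms(1)] cong[OF assms] by simp

lemma subfunctor:
  assumes "\<And>n. T n \<subseteq> C n" and "\<And>n. 0 \<in> T n"
    and "\<And>n x y. x \<in> T n \<Longrightarrow> y \<in> T n \<Longrightarrow> x - y \<in> T n"
    and "\<And>m n A x. x \<in> T m \<Longrightarrow> F m n A x \<in> T n"
  shows "matrix_functor p D T F"
proof (unfold_locales)
  have T: "x \<in> C n" if "x \<in> T n" for x n
    using assms(1) that by blast
  show "\<exists>L. coordinate_system p (T n) L" for n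
    using coordinates coordinate_system_subset assms(1) by blast
  show "finite (T n)" for n
    using assms(1) finite finite_subset by blast
  show "F m n A x = F m n B x"
    if "x \<in> T m" "\<And>i j. i < n \<Longrightarrow> j < m \<Longrightarrow> A i j = B i j" for x m n A B
    using cong[OF T[OF that(1)] that(2)] .
qed (use assms(2-4) prime add comp unit degree subsetD[OF assms(1)] in auto)

text \<open>
  A value at \<open>K\<^bsup>m+v\<^esup>\<close> that vanishes in \<open>K\<^sup>v\<close> is killed by all \<open>0 \<oplus> \<phi>\<close>. Since differences of order
  \<open>D - 1\<close> are constant, those at \<open>1 \<oplus> \<phi>\<close> equal those at \<open>0 \<oplus> \<phi>\<close>: the degree drops.
\<close>

definition shift_kernel :: "nat \<Rightarrow> nat \<Rightarrow> 'g set" where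
  "shift_kernel m v = {x \<in> C (m + v). F (m + v) v (shift_cols m unit_matrix) x = 0}"

text \<open>The matrix 0 + A factors through the projection to K^v, which kills x.\<close>

lemma shift_kernel_zero_block:
  assumes "x \<in> shift_kernel m v"
  shows "F (m + v) (m + w) (shift_rows m (shift_cols m A)) x = 0"
proof -
  have "F v (m + w) (shift_rows m A) (F (m + v) v (shift_cols m unit_matrix) x)
      = F (m + v) (m + w) (shift_rows m (shift_cols m A)) x"
    using assms
    by (intro comp_eq)
       (auto simp: shift_kernel_def matrix_prod_shift_cols shift_cols_def matrix_prod_unit_right shift_rows_def)
  then show ?thesis
    using assms zero by (simp add: shift_kernel_def)
qed

lemma shift_kernel_closed:
  assumes "x \<in> shift_kernel m v"
  shows "F (m + v) (m + w) (unit_block m A) x \<in> shift_kernel m w"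
proof -
  have x: "x \<in> C (m + v)" "F (m + v) v (shift_cols m unit_matrix) x = 0"
    using assms by (auto simp: shift_kernel_def)
  have "F (m + w) w (shift_cols m unit_matrix) (F (m + v) (m + w) (unit_block m A) x)
      = F (m + v) w (shift_cols m A) x"
    by (intro comp_eq x)
       (simp add: matrix_prod_shift_cols_left matrix_prod_unit_left unit_above_def)
  also have "\<dots> = F v w A (F (m + v) v (shift_cols m unit_matrix) x)"
    by (rule comp_eq[symmetric, OF x(1)])
       (auto simp: matrix_prod_shift_cols shift_cols_def matrix_prod_unit_right)
  finally show ?thesis
    using x zero closed by (simp add: shift_kernel_def)
qed

lemma shift_kernel_degree:
  assumes "x \<in> shift_kernel m v" and "length as = D - 1" and "0 < D"
  shows "iter_diff as (\<lambda>A. F (m + v) (m + w) (unit_block m A) x) B = 0"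
proof -
  define f where "f M = F (m + v) (m + w) M x" for M
  define l where "l A = shift_rows m (shift_cols m A)" for A
  \<comment> \<open>\<open>P\<close> is the identity of K^m plus 0, so that the block 1 + A is the
    translate of \<open>l A\<close> by \<open>P\<close>.\<close>
  define P where "P i j = (if i < m then unit_matrix i j else 0)" for i j
  have l_add: "l (A + B) = l A + l B" for A B
    by (auto simp: l_def shift_rows_def shift_cols_def fun_eq_iff)
  have block: "unit_block m A = l A + P" for A
    by (auto simp: l_def P_def shift_rows_def shift_cols_def unit_above_def fun_eq_iff)
  have "iter_diff as (\<lambda>A. f (l A + P)) B = iter_diff (map l as) f (l B + P)"
    by (rule iter_diff_affine) (simp only: l_add ac_simps)
  moreover have "iter_diff as (\<lambda>A. f (l A)) B = iter_diff (map l as) f (l B)"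
    by (rule iter_diff_affine) (simp only: l_add ac_simps)
  moreover have "f (l A) = 0" for A
    unfolding f_def l_def using shift_kernel_zero_block[OF assms(1)] .
  \<comment> \<open>With \<open>P\<close> as an additional direction there are D differences in all,
    so the result vanishes. It is the (D-1)-fold difference at \<open>l B + P\<close> minus the one
    at \<open>l B\<close>, and the latter is 0.\<close>
  moreover have "iter_diff (P # map l as) f (l B) = 0"
    unfolding f_def using assms by (intro degree) (auto simp: shift_kernel_def)
  ultimately have "iter_diff as (\<lambda>A. f (l A + P)) B = 0"
    by (simp add: iter_diff_zero)
  then show ?thesis
    by (simp add: f_def block)
qed

lemma shift_functor:
  assumes "0 < D"
  shows "matrix_functor p (D - 1) (shift_kernel m) (\<lambda>v w A. F (m + v) (m + w) (unit_block m A))"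
proof (unfold_locales)
  show "\<exists>L. coordinate_system p (shift_kernel m n) L" for n
    using coordinates[of "m + n"] coordinate_system_subset[of p "C (m + n)" _ "shift_kernel m n"]
    by (auto simp: shift_kernel_def)
  show "F (m + v) (m + w) (unit_block m A) x = F (m + v) (m + w) (unit_block m B) x"
    if "x \<in> shift_kernel m v" "\<And>i j. i < w \<Longrightarrow> j < v \<Longrightarrow> A i j = B i j" for x v w A B
    using that by (intro cong) (auto simp: shift_kernel_def unit_above_def shift_cols_def)
  show "F (m + v) (m + w) (unit_block m A) (F (m + k) (m + v) (unit_block m B) x)
      = F (m + k) (m + w) (unit_block m (matrix_prod v A B)) x"
    if "x \<in> shift_kernel m k" for x v w k A B
    using that by (intro comp_eq) (auto simp: shift_kernel_def matrix_prod_unit_block)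
  show "F (m + n) (m + n) (unit_block m unit_matrix) x = x" if "x \<in> shift_kernel m n" for x n
    using that by (intro unit_eq) (auto simp: shift_kernel_def unit_above_def shift_cols_def unit_matrix_def)
  show "iter_diff as (\<lambda>A. F (m + v) (m + w) (unit_block m A) x) B = 0"
    if "x \<in> shift_kernel m v" "length as = D - 1" for x v w as B
    using shift_kernel_degree[OF that assms] .
qed (auto simp: shift_kernel_closed, auto simp: shift_kernel_def prime zero_mem zero diff_mem diff add finite)

end

text \<open>Dropping the first coordinate gives a surjection \<open>C (n + 1)\<close> ->
  \<open>C n\<close>, split by the inclusion, with kernel \<open>shift_kernel 1 n\<close>. The
  kernel is a functor of smaller degree, so by induction the exponent has polynomial
  increments.\<close>

lemma card_matrix_functor:
  assumes "matrix_functor p D C F"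
  shows "\<exists>f. polynomial_sequence f \<and> (\<forall>n. card (C n) = p ^ f n)"
  using assms
proof (induction D arbitrary: C F)
  case 0
  then interpret matrix_functor p 0 C F .
  \<comment> \<open>A functor of degree less than 0 is zero: the empty iterated difference at the
    unit matrix is x itself.\<close>
  have "x = 0" if "x \<in> C n" for x n
    using degree[OF that, of "[]" n unit_matrix] unit[OF that] by simp
  then have "C n = {0}" for n
    using zero_mem by blast
  then show ?case
    using polynomial_sequence_const[of 0] by (intro exI[of _ "\<lambda>_. 0"]) simp
next
  case (Suc D)
  then interpret matrix_functor p "Suc D" C F by simp
  have "matrix_functor p D (shift_kernel 1) (\<lambda>v w A. F (1 + v) (1 + w) (unit_block 1 A))"
    using shift_functor[of 1] by simp
  then obtain g where g: "polynomial_sequence g" "\<And>n. card (shift_kernel 1 n) = p ^ g n"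
    using Suc.IH by blast
  have "\<exists>k. card (C n) = p ^ k" for n
    using coordinates[of n] card_coordinate_system[OF prime _ finite _ diff_mem, of n] zero_mem by blast
  then obtain f where f: "\<And>n. card (C n) = p ^ f n"
    by metis
  have "f (Suc n) = g n + f n" for n
  proof -
    let ?r = "F (Suc n) n (shift_cols 1 unit_matrix)" and ?s = "F n (Suc n) (shift_rows 1 unit_matrix)"
    have "?r (?s y) = y" if "y \<in> C n" for y
    proof -
      have "?r (?s y) = F n n unit_matrix y"
        using that matrix_prod_shift_cols_left[of 1 n]
        by (intro comp_eq) (simp_all add: matrix_prod_unit_left shift_rows_def)
      then show ?thesis
        using unit that by simp
    qed
    then have "C n \<subseteq> ?r ` C (Suc n)"
      using closed[of _ n "Suc n" "shift_rows 1 unit_matrix"] by (intro subsetI image_eqI[of _ ?r]) auto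
    then have "?r ` C (Suc n) = C n"
      using closed by blast
    moreover have "card (C (Suc n)) = card (?r ` C (Suc n)) * p ^ g n"
    proof (rule card_equal_fibres[OF finite])
      fix y assume "y \<in> ?r ` C (Suc n)"
      then obtain x where x: "x \<in> C (Suc n)" "y = ?r x"
        by blast
      show "card {x \<in> C (Suc n). ?r x = y} = p ^ g n"
        unfolding x(2) g(2)[symmetric]
        by (rule card_coset) (use x in \<open>auto simp: shift_kernel_def diff diff_mem\<close>)
    qed
    ultimately have "p ^ f (Suc n) = p ^ (g n + f n)"
      by (simp add: f power_add mult.commute)
    then show ?thesis
      using prime_gt_1_nat[OF prime] by simp
  qed
  then show ?case
    using polynomial_sequence_of_differences[OF g(1)] f by blast
qed

section \<open>A functor of degree less than \<open>D\<close> is determined by its value at \<open>K\<^sup>D\<close>\<close>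

definition diagonal :: "nat set \<Rightarrow> int_matrix" where
  "diagonal J i j = of_bool (i = j \<and> i \<in> J)"

lemma diagonal_insert: "j \<notin> J \<Longrightarrow> diagonal J + diagonal {j} = diagonal (insert j J)"
  by (auto simp: diagonal_def fun_eq_iff)

text \<open>Inclusion-exclusion: the iterated difference in the directions of \<open>js\<close> is
  the alternating sum of the values of f at the diagonals of \<open>J\<close> together with the
  subsets of \<open>js\<close>. All terms but the one for the full set lie in
  \<open>T\<close>.\<close>

lemma iter_diff_diagonal:
  fixes T :: "'g::ab_group_add set"
  assumes T: "0 \<in> T" "\<And>u v. u \<in> T \<Longrightarrow> v \<in> T \<Longrightarrow> u - v \<in> T"
    and "distinct js" "set js \<inter> J = {}" and "\<And>I. I \<subset> J \<union> set js \<Longrightarrow> f (diagonal I) \<in> T"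
  shows "iter_diff (map (\<lambda>j. diagonal {j}) js) f (diagonal J) - f (diagonal (J \<union> set js)) \<in> T"
  using assms(3-)
proof (induction js arbitrary: J)
  case Nil
  then show ?case using T by simp
next
  case (Cons j js)
  let ?d = "\<lambda>J. iter_diff (map (\<lambda>j. diagonal {j}) js) f (diagonal J)"
  have "?d (insert j J) - f (diagonal (insert j J \<union> set js)) \<in> T"
    using Cons.prems by (intro Cons.IH) auto
  moreover have "?d J - f (diagonal (J \<union> set js)) \<in> T"
    using Cons.prems by (intro Cons.IH) (auto intro!: Cons.prems(3))
  moreover have "f (diagonal (J \<union> set js)) \<in> T"
    using Cons.prems by (intro Cons.prems(3)) auto
  moreover have "u + v \<in> T" if "u \<in> T" "v \<in> T" for u v
    using T(2)[OF that(1) T(2)[OF T(1) that(2)]] by simp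
  ultimately have "?d (insert j J) - f (diagonal (insert j J \<union> set js)) - (?d J - f (diagonal (J \<union> set js)) + f (diagonal (J \<union> set js))) \<in> T"
    using T(2) by blast
  then show ?case
    using Cons.prems by (simp add: diagonal_insert algebra_simps)
qed

context matrix_functor
begin

text \<open>The identity of K^v is \<open>diagonal {..<v}\<close>, so it suffices to treat the
  matrices \<open>diagonal J\<close>, by induction on the size of J. Those with fewer than D entries
  factor through K^D, where the hypothesis \<open>val\<close> applies. For larger J, a D-fold
  difference in D of the directions of J vanishes, which expresses the value at J by values at
  proper subsets.\<close>

lemma determined_by_value:
  assumes T: "\<And>n. 0 \<in> T n" "\<And>n x y. x \<in> T n \<Longrightarrow> y \<in> T n \<Longrightarrow> x - y \<in> T n"
      "\<And>m n A x. x \<in> T m \<Longrightarrow> F m n A x \<in> T n"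
    and r: "r \<in> C v" and val: "\<And>A. F v D A r \<in> T D"
  shows "r \<in> T v"
proof -
  have "F v v (diagonal J) r \<in> T v" if "finite J" for J
    using that
  proof (induction "card J" arbitrary: J rule: less_induct)
    case less
    show ?case
    proof (cases "card J < D")
      case True
      obtain e where e: "bij_betw e {..<card J} J"
        using ex_bij_betw_nat_finite[OF less.prems] by (auto simp: atLeast0LessThan)
      \<comment> \<open>\<open>B\<close> writes the coordinates in \<open>J\<close>, enumerated by
        \<open>e\<close>, into the first \<open>card J\<close> of the D places; its transpose puts
        them back.\<close>
      define B where "B l j = (of_bool (l < card J \<and> e l = j) :: int)" for l j
      have "matrix_prod D (\<lambda>i l. B l i) B i j = diagonal J i j" for i j
      proof (cases "i = j \<and> i \<in> J")
        case True
        then obtain l where l: "l < card J" "e l = j"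
          using e by (metis bij_betw_imp_surj_on imageE lessThan_iff)
        have "l' < card J \<and> e l' = j \<longleftrightarrow> l' = l" for l'
          using bij_betw_imp_inj_on[OF e] l by (auto dest: inj_onD)
        then have "B l' i * B l' j = of_bool (l' = l)" for l'
          using True by (simp add: B_def)
        then show ?thesis
          using l(1) \<open>card J < D\<close> True by (auto simp: matrix_prod_def diagonal_def of_bool_def sum.delta)
      next
        case False
        then have "B l i * B l j = 0" for l
          using e by (auto simp: B_def bij_betw_def)
        then show ?thesis
          using False by (auto simp: matrix_prod_def diagonal_def simp del: mult_eq_0_iff)
      qed
      then have "F D v (\<lambda>i l. B l i) (F v D B r) = F v v (diagonal J) r"
        by (intro comp_eq r)
      then show ?thesis
        using T(3)[OF val] by metis
    next
      case False
      then obtain I where I: "I \<subseteq> J" "card I = D"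
        by (metis obtain_subset_with_card_n not_less)
      then obtain js where js: "set js = I" "distinct js"
        using less.prems finite_distinct_list finite_subset by metis
      have J: "J - I \<union> set js = J" "set js \<inter> (J - I) = {}"
        using I js by auto
      have sub: "F v v (diagonal I') r \<in> T v" if "I' \<subset> J" for I'
        using less.prems that by (intro less.hyps psubset_card_mono) (auto intro: finite_subset)
      have "iter_diff (map (\<lambda>j. diagonal {j}) js) (\<lambda>A. F v v A r) (diagonal (J - I))
          - F v v (diagonal (J - I \<union> set js)) r \<in> T v"
        by (rule iter_diff_diagonal[where f = "\<lambda>A. F v v A r"]) (use T js(2) J sub in simp_all)
      moreover have "iter_diff (map (\<lambda>j. diagonal {j}) js) (\<lambda>A. F v v A r) (diagonal (J - I)) = 0"
        using I js distinct_card[of js] by (intro degree r) simp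
      ultimately have "0 - F v v (diagonal J) r \<in> T v"
        by (simp add: J)
      then show ?thesis
        using T(2)[OF T(1)] by force
    qed
  qed
  then have "F v v (diagonal {..<v}) r \<in> T v"
    by simp
  moreover have "F v v (diagonal {..<v}) r = r"
    by (rule unit_eq[OF r]) (auto simp: diagonal_def unit_matrix_def)
  ultimately show ?thesis
    by simp
qed

end

section \<open>Subsets of a functor\<close>

text \<open>Translation by v is injective on the finite set, hence surjective, and so hits 0. It is
  needed because the definition of the stabilizer shows closure under addition only.\<close>

lemma finite_add_closed_diff:
  fixes S :: "'g::ab_group_add set"
  assumes "finite S" "0 \<in> S" and add: "\<And>u v. u \<in> S \<Longrightarrow> v \<in> S \<Longrightarrow> u + v \<in> S"
    and "u \<in> S" "v \<in> S"
  shows "u - v \<in> S"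
proof -
  have "(\<lambda>w. w + v) ` S = S"
    using assms by (intro endo_inj_surj) (auto intro: inj_onI)
  then obtain w where "w \<in> S" "w + v = 0"
    using \<open>0 \<in> S\<close> by (metis imageE)
  then have "- v \<in> S"
    by (simp add: eq_neg_iff_add_eq_0[symmetric])
  then show ?thesis
    using add[OF \<open>u \<in> S\<close>] by fastforce
qed

locale functor_subset = matrix_functor +
  fixes X :: "nat \<Rightarrow> 'a set"
  assumes subset: "X n \<subseteq> C n"
    and X_closed: "x \<in> X m \<Longrightarrow> F m n A x \<in> X n"
begin

definition over :: "nat \<Rightarrow> 'a \<Rightarrow> nat \<Rightarrow> 'a set" where
  "over m x n = {y \<in> X n. F n m unit_matrix y = x}"

text \<open>
  The stabilizer is tested against all points over \<open>x\<close>, not only those at \<open>m + v\<close>: this makes it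
  a subfunctor that grows when \<open>x\<close> is replaced by a point over \<open>x\<close>.
\<close>

definition stabilizer :: "nat \<Rightarrow> 'a \<Rightarrow> nat \<Rightarrow> 'a set" where
  "stabilizer m x v = {r \<in> C v. F v 0 unit_matrix r = 0 \<and>
     (\<forall>w A y. y \<in> over m x (m + w) \<longrightarrow> y + F v (m + w) (shift_rows m A) r \<in> X (m + w))}"

text \<open>Here r is a difference that occurs between two points over x, at some single place, and
  b is never an image of such an r. Testing images in one fixed K^k leaves only finitely many b to
  be treated, although r ranges over all spaces.\<close>

definition avoids :: "nat \<Rightarrow> 'a \<Rightarrow> nat \<Rightarrow> 'a \<Rightarrow> bool" where
  "avoids k b m x \<longleftrightarrow> (\<forall>v y r A. y \<in> over m x (m + v) \<longrightarrow> r \<in> C v \<longrightarrow>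
     y + F v (m + v) (shift_rows m unit_matrix) r \<in> X (m + v) \<longrightarrow> F v k A r \<noteq> b)"

lemma X_C: "x \<in> X n \<Longrightarrow> x \<in> C n"
  using subset by blast

lemma over_X: "y \<in> over m x n \<Longrightarrow> y \<in> X n"
  by (simp add: over_def)

lemma over_C: "y \<in> over m x n \<Longrightarrow> y \<in> C n"
  by (simp add: over_def X_C)

lemma over_self: "x \<in> X m \<Longrightarrow> x \<in> over m x m"
  by (simp add: over_def unit X_C)

lemma over_trans:
  assumes "m \<le> m'" "y \<in> over m x m'" "z \<in> over m' y n"
  shows "z \<in> over m x n"
proof -
  have "F m' m unit_matrix (F n m' unit_matrix z) = F n m unit_matrix z"
    using assms by (intro comp_eq over_C[OF assms(3)]) (auto simp: matrix_prod_unit_left)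
  then show ?thesis
    using assms by (auto simp: over_def)
qed

text \<open>This is the purpose of the condition at K^0 in \<open>stabilizer\<close>: the composite
  matrix to K^m is zero and hence factors through K^0. Translation by the image of r therefore
  leaves the projection to K^m unchanged.\<close>

lemma shift_rows_to_base:
  assumes "r \<in> C v" "F v 0 unit_matrix r = 0"
  shows "F (m + w) m unit_matrix (F v (m + w) (shift_rows m A) r) = 0"
proof -
  have "F (m + w) m unit_matrix (F v (m + w) (shift_rows m A) r) = F v m (\<lambda>_ _. 0) r"
    by (rule comp_eq[OF assms(1)]) (auto simp: matrix_prod_unit_left shift_rows_def)
  also have "\<dots> = F 0 m unit_matrix (F v 0 unit_matrix r)"
    by (rule comp_eq[OF assms(1), symmetric]) (auto simp: matrix_prod_def)
  finally show ?thesis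
    using assms zero by simp
qed

lemma over_add_stabilizer:
  assumes "y \<in> over m x (m + w)" "r \<in> stabilizer m x v"
  shows "y + F v (m + w) (shift_rows m A) r \<in> over m x (m + w)"
proof -
  have "F (m + w) m unit_matrix (y + F v (m + w) (shift_rows m A) r) = x"
    using assms by (subst add) (auto simp: over_C closed stabilizer_def shift_rows_to_base, auto simp: over_def)
  then show ?thesis
    using assms by (auto simp: over_def stabilizer_def)
qed

lemma stabilizer_C: "stabilizer m x v \<subseteq> C v"
  by (auto simp: stabilizer_def)

lemma stabilizer_zero: "0 \<in> stabilizer m x v"
  by (auto simp: stabilizer_def zero_mem zero over_X)

lemma stabilizer_add:
  assumes "r \<in> stabilizer m x v" "s \<in> stabilizer m x v"
  shows "r + s \<in> stabilizer m x v"
proof -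
  have rs: "r \<in> C v" "s \<in> C v"
    using assms stabilizer_C by auto
  have "y + F v (m + w) (shift_rows m A) (r + s) \<in> X (m + w)" if "y \<in> over m x (m + w)" for w A y
    using over_X[OF over_add_stabilizer[OF over_add_stabilizer[OF that assms(1)] assms(2)], of A A]
    by (simp add: add rs add.assoc)
  then show ?thesis
    using rs assms add[OF rs] add_mem[OF rs] by (simp add: stabilizer_def)
qed

lemma stabilizer_diff:
  "r \<in> stabilizer m x v \<Longrightarrow> s \<in> stabilizer m x v \<Longrightarrow> r - s \<in> stabilizer m x v"
  by (rule finite_add_closed_diff)
     (auto intro: finite_subset[OF stabilizer_C finite] stabilizer_zero stabilizer_add)

lemma stabilizer_closed:
  assumes "r \<in> stabilizer m x v"
  shows "F v w A r \<in> stabilizer m x w"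
proof -
  have r: "r \<in> C v" "F v 0 unit_matrix r = 0"
    using assms by (auto simp: stabilizer_def)
  have "F w 0 unit_matrix (F v w A r) = F v 0 unit_matrix r"
    by (rule comp_eq[OF r(1)]) simp
  moreover have "F w (m + u) (shift_rows m B) (F v w A r) = F v (m + u) (shift_rows m (matrix_prod w B A)) r" for u B
    by (rule comp_eq[OF r(1)]) (simp add: matrix_prod_shift_rows)
  ultimately show ?thesis
    using assms r closed by (simp add: stabilizer_def)
qed

lemma stabilizer_determined:
  assumes "r \<in> C v" and "\<And>A. F v D A r \<in> stabilizer m x D"
  shows "r \<in> stabilizer m x v"
  by (rule determined_by_value[OF stabilizer_zero stabilizer_diff stabilizer_closed assms])

lemma stabilizer_mono:
  assumes "m \<le> m'" "y \<in> over m x m'"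
  shows "stabilizer m x v \<subseteq> stabilizer m' y v"
proof
  fix r assume r: "r \<in> stabilizer m x v"
  have "z + F v (m' + w) (shift_rows m' A) r \<in> X (m' + w)" if z: "z \<in> over m' y (m' + w)" for w A z
  proof -
    have d: "m' + w = m + (m' - m + w)" and "shift_rows m' A = shift_rows m (shift_rows (m' - m) A)"
      using assms(1) by (auto simp: shift_rows_def fun_eq_iff)
    moreover have "z \<in> over m x (m + (m' - m + w))"
      using over_trans[OF assms z] unfolding d .
    ultimately show ?thesis
      using r unfolding stabilizer_def by (metis (no_types, lifting) mem_Collect_eq)
  qed
  then show "r \<in> stabilizer m' y v"
    using r by (simp add: stabilizer_def)
qed

lemma stabilizer_functor: "matrix_functor p D (stabilizer m x) F"
  by (intro subfunctor stabilizer_C stabilizer_zero stabilizer_diff stabilizer_closed)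

lemma avoids_mono:
  assumes "avoids k b m x" "m \<le> m'" "y \<in> over m x m'"
  shows "avoids k b m' y"
  unfolding avoids_def
proof (intro allI impI)
  fix v z r A
  assume z: "z \<in> over m' y (m' + v)" and r: "r \<in> C v"
    and zr: "z + F v (m' + v) (shift_rows m' unit_matrix) r \<in> X (m' + v)"
  define d where "d = m' - m"
  have d: "m' = m + d" "m' + v = m + (d + v)"
    using assms(2) by (auto simp: d_def)
  \<comment> \<open>The \<open>d\<close> coordinates between m and m' are counted as part of V;
    \<open>?s\<close> is r placed behind them, and \<open>shift_cols d A\<close> ignores
    them.\<close>
  let ?s = "F v (d + v) (shift_rows d unit_matrix) r"
  have "F (d + v) (m + (d + v)) (shift_rows m unit_matrix) ?s = F v (m + (d + v)) (shift_rows m' unit_matrix) r"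
    by (rule comp_eq[OF r]) (auto simp: matrix_prod_shift_rows shift_rows_def matrix_prod_unit_left d(1))
  moreover have "F (d + v) k (shift_cols d A) ?s = F v k A r"
    by (rule comp_eq[OF r]) (simp add: matrix_prod_shift_rows_right shift_cols_def matrix_prod_unit_right)
  moreover have "z \<in> over m x (m + (d + v))"
    using over_trans[OF assms(2,3) z] d(2) by simp
  ultimately show "F v k A r \<noteq> b"
    using assms(1) zr closed[OF r] d(2) unfolding avoids_def by metis
qed

text \<open>
  Let \<open>f y\<close> be the indicator function of those \<open>A\<close> for which \<open>F (1, A) y\<close> lies in the set of
  points that leave \<open>X\<close> when the image of \<open>b\<close> is added. Choose \<open>y\<close> over \<open>x\<close> such that \<open>f y\<close> has the
  largest possible degree. Passing to a point \<open>u\<close> over \<open>y\<close> does not increase the degree, so the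
  leading differences of \<open>f u\<close> do not change under translations in the new columns, and hence
  \<open>f u\<close> does not vanish on any translate of the matrices supported on the old columns. If
  \<open>u + r\<close> were in \<open>X\<close> and \<open>b\<close> an image of \<open>r\<close>, one could map \<open>r\<close> to \<open>b\<close> and at the same time \<open>u\<close>
  to a point that leaves \<open>X\<close> under addition of \<open>b\<close>.
\<close>

lemma exists_avoiding:
  assumes b: "b \<in> C k" and z: "z \<in> over m x (m + w)"
    and zb: "z + F k (m + w) (shift_rows m B) b \<notin> X (m + w)"
  obtains m' y where "m \<le> m'" "y \<in> over m x m'" "avoids k b m' y"
proof -
  define Z where "Z = {y \<in> X (m + w). y + F k (m + w) (shift_rows m B) b \<notin> X (m + w)}"
  define f where "f m' y A = (of_bool (F m' (m + w) (unit_above m A) y \<in> Z) :: int)" for m' y A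
  have above_add: "unit_above m (A + A') = unit_above m A + shift_rows m A'" for A A'
    by (auto simp: unit_above_def shift_rows_def fun_eq_iff)
  obtain L where L: "coordinate_system p (C (m + w)) L"
    using coordinates by blast
  obtain E where E: "\<And>(g :: int_matrix \<Rightarrow> 'a) Z. (\<And>x. g x \<in> C (m + w)) \<Longrightarrow>
      (\<And>as x. length as = D \<Longrightarrow> iter_diff as g x = 0) \<Longrightarrow> Z \<subseteq> C (m + w) \<Longrightarrow>
      degree_less p E (\<lambda>x. of_bool (g x \<in> Z))"
    using indicator_degree_bound[OF prime L finite diff_mem, of D] by blast
  \<comment> \<open>One \<open>E\<close> serves all \<open>m'\<close> and \<open>y\<close>, because
    the values always lie in the fixed finite group \<open>C (m + w)\<close>.\<close>
  have bound: "degree_less p E (f m' y)" if "y \<in> C m'" for m' y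
    unfolding f_def
  proof (rule E)
    fix as A assume "length (as :: int_matrix list) = D"
    then show "iter_diff as (\<lambda>A. F m' (m + w) (unit_above m A) y) A = 0"
      by (subst iter_diff_affine[where f = "\<lambda>M. F m' (m + w) M y" and h = "unit_above m", OF above_add])
         (simp add: degree that)
  qed (use that closed X_C in \<open>auto simp: Z_def\<close>)
  define Q where "Q n \<longleftrightarrow> (\<exists>m' y as A. m \<le> m' \<and> y \<in> over m x m' \<and> length as = n \<and>
      \<not> int p dvd iter_diff as (f m' y) A)" for n
  have "Q 0"
  proof -
    \<comment> \<open>With this \<open>A\<close> the matrix \<open>unit_above m A\<close> is the
      identity of K^(m+w), and z itself lies in \<open>Z\<close>.\<close>
    define A where "A i j = (of_bool (i + m = j) :: int)" for i j
    have "F (m + w) (m + w) (unit_above m A) z = z"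
      by (rule unit_eq[OF over_C[OF z]]) (auto simp: unit_above_def A_def unit_matrix_def)
    then have "f (m + w) z A = 1"
      using over_X[OF z] zb by (simp add: f_def Z_def)
    then have "\<not> int p dvd iter_diff [] (f (m + w) z) A"
      using prime_gt_1_nat[OF prime] by simp
    then show ?thesis
      unfolding Q_def using z by (metis le_add1 list.size(3))
  qed
  moreover have "n \<le> E" if "Q n" for n
  proof (rule ccontr)
    assume "\<not> n \<le> E"
    obtain m' y as A where y: "y \<in> over m x m'" "length as = n" "\<not> int p dvd iter_diff as (f m' y) A"
      using \<open>Q n\<close> unfolding Q_def by blast
    moreover have "degree_less p n (f m' y)"
      using \<open>\<not> n \<le> E\<close> by (intro degree_less_mono[OF bound[OF over_C[OF y(1)]]]) simp
    ultimately show False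
      by (simp add: degree_less_def)
  qed
  ultimately have "\<exists>n. Q n \<and> (\<forall>n'. Q n' \<longrightarrow> n' \<le> n)"
    using Nat.ex_has_greatest_nat[of Q 0 E] by simp
  then obtain n where "Q n" and max: "\<And>n'. Q n' \<Longrightarrow> n' \<le> n"
    by blast
  then obtain m' y as A0 where m': "m \<le> m'" and y: "y \<in> over m x m'" and as: "length as = n"
    and A0: "\<not> int p dvd iter_diff as (f m' y) A0"
    unfolding Q_def by blast
  have "avoids k b m' y"
    unfolding avoids_def
  proof (intro allI impI notI)
    fix v u r G
    assume u: "u \<in> over m' y (m' + v)" and r: "r \<in> C v" and Gr: "F v k G r = b"
      and ur: "u + F v (m' + v) (shift_rows m' unit_matrix) r \<in> X (m' + v)"
    define cut where "cut A i j = (if j < m' then A i j else 0)" for A :: int_matrix and i j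
    \<comment> \<open>\<open>S\<close> is supported on the new columns, where r lives, and sends r
      by \<open>G\<close> to b and then by \<open>B\<close> to the vector whose addition leads out
      of X.\<close>
    define S where "S = shift_cols m' (matrix_prod k B G)"
    have cut_add: "cut (A + A') = cut A + cut A'" for A A'
      by (auto simp: cut_def fun_eq_iff)
    have "F m' (m + w) (unit_above m A) (F (m' + v) m' unit_matrix u) =
        F (m' + v) (m + w) (unit_above m (cut A)) u" for A
      using m' by (intro comp_eq over_C[OF u])
        (auto simp: matrix_prod_unit_right unit_above_def cut_def unit_matrix_def)
    then have f_cut: "f m' y = (\<lambda>A. f (m' + v) u (cut A))"
      using u by (auto simp: f_def over_def fun_eq_iff)
    have "\<not> int p dvd iter_diff (map cut as) (f (m' + v) u) (cut A0)"
      using A0 unfolding f_cut iter_diff_affine[where f = "f (m' + v) u" and h = cut, OF cut_add] .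
    moreover have "int p dvd iter_diff (S # map cut as) (f (m' + v) u) (cut A0)"
    proof (rule ccontr)
      assume "\<not> ?thesis"
      then have "Q (Suc n)"
        unfolding Q_def using over_trans[OF m' y u] m' as
        by (intro exI[of _ "m' + v"] exI[of _ u] exI[of _ "S # map cut as"] exI[of _ "cut A0"]) auto
      then show False
        using max by fastforce
    qed
    ultimately have "\<not> int p dvd iter_diff (map cut as) (f (m' + v) u) (cut A0 + S)"
      by (auto simp: dvd_diff_right_iff)
    also have "iter_diff (map cut as) (f (m' + v) u) (cut A0 + S)
        = iter_diff as (\<lambda>A. f (m' + v) u (cut A + S)) A0"
      by (rule iter_diff_affine[symmetric]) (simp only: cut_add ac_simps)
    finally obtain A where "f (m' + v) u (cut A + S) \<noteq> 0"
      using iter_diff_zero[of "\<lambda>A. f (m' + v) u (cut A + S)"] by (metis dvd_0_right)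
    define M where "M = unit_above m (cut A + S)"
    have MuZ: "F (m' + v) (m + w) M u \<in> Z"
      using \<open>f (m' + v) u (cut A + S) \<noteq> 0\<close> by (simp add: f_def M_def)
    have "F (m' + v) (m + w) M (F v (m' + v) (shift_rows m' unit_matrix) r) =
        F v (m + w) (shift_rows m (matrix_prod k B G)) r"
      using m' by (intro comp_eq[OF r])
        (auto simp: matrix_prod_shift_rows_right matrix_prod_unit_right M_def unit_above_def
          unit_matrix_def shift_rows_def S_def cut_def shift_cols_def)
    also have "\<dots> = F k (m + w) (shift_rows m B) b"
      unfolding Gr[symmetric] by (rule comp_eq[OF r, symmetric]) (simp add: matrix_prod_shift_rows)
    finally have "F (m' + v) (m + w) M (u + F v (m' + v) (shift_rows m' unit_matrix) r)
        = F (m' + v) (m + w) M u + F k (m + w) (shift_rows m B) b"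
      by (simp add: add over_C[OF u] closed r)
    then show False
      using MuZ X_closed[OF ur, of "m + w" M] by (simp add: Z_def)
  qed
  then show thesis
    using that m' y by blast
qed

text \<open>If an occurring difference r is not in the stabilizer, then some image b of r in K^D is
  not in it either, as the stabilizer is determined there. There are finitely many such b; they are
  excluded one after another, since \<open>avoids\<close> persists at points over the current one
  and the maximal stabilizer no longer changes.\<close>

lemma exists_point_with_coset_fibres:
  assumes "x0 \<in> X m0"
  obtains m x where "x \<in> X m"
    and "\<And>v y r. y \<in> over m x (m + v) \<Longrightarrow> r \<in> C v \<Longrightarrow> F v 0 unit_matrix r = 0 \<Longrightarrow>
      y + F v (m + v) (shift_rows m unit_matrix) r \<in> X (m + v) \<Longrightarrow> r \<in> stabilizer m x v"
proof -
  have "card (stabilizer m x D) < Suc (card (C D))" for m x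
    by (intro le_imp_less_Suc card_mono stabilizer_C finite)
  then obtain m1 x1 where x1: "x1 \<in> X m1"
    and max: "\<And>m x. x \<in> X m \<Longrightarrow> card (stabilizer m x D) \<le> card (stabilizer m1 x1 D)"
    using ex_has_greatest_nat[of "\<lambda>(m, x). x \<in> X m" "(m0, x0)" "\<lambda>(m, x). card (stabilizer m x D)" "Suc (card (C D))"]
      assms by auto
  have stable: "stabilizer m x v = stabilizer m1 x1 v" if "m1 \<le> m" "x \<in> over m1 x1 m" for m x v
  proof
    \<comment> \<open>By monotonicity and maximal cardinality the two agree at K^D;
      \<open>stabilizer_determined\<close> extends this to every K^v.\<close>
    have "stabilizer m1 x1 D = stabilizer m x D"
      using max[OF over_X[OF that(2)]] stabilizer_mono[OF that] finite_subset[OF stabilizer_C finite]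
      by (intro card_seteq)
    then have "r \<in> stabilizer m1 x1 v" if "r \<in> stabilizer m x v" for r
      using stabilizer_closed[OF that] by (intro stabilizer_determined[OF subsetD[OF stabilizer_C that]]) simp
    then show "stabilizer m x v \<subseteq> stabilizer m1 x1 v"
      by blast
  qed (rule stabilizer_mono[OF that])
  have "\<exists>m x. m1 \<le> m \<and> x \<in> over m1 x1 m \<and> (\<forall>b\<in>B. avoids D b m x)"
    if "finite B" "B \<subseteq> {b \<in> C D. F D 0 unit_matrix b = 0} - stabilizer m1 x1 D" for B
    using that
  proof (induction B rule: finite_induct)
    case empty
    then show ?case using over_self[OF x1] by blast
  next
    case (insert b B)
    then obtain m x where m: "m1 \<le> m" and x: "x \<in> over m1 x1 m" and B: "\<forall>b\<in>B. avoids D b m x"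
      by auto
    \<comment> \<open>Since b satisfies the condition at K^0, it can fail to be in the stabilizer
      only through a point z that a translate moves out of X.\<close>
    have b: "b \<in> C D" "F D 0 unit_matrix b = 0" "b \<notin> stabilizer m x D"
      using insert.prems stable[OF m x] by auto
    then obtain w A z where "z \<in> over m x (m + w)" "z + F D (m + w) (shift_rows m A) b \<notin> X (m + w)"
      by (auto simp: stabilizer_def)
    then obtain m' y where "m \<le> m'" "y \<in> over m x m'" "avoids D b m' y"
      using exists_avoiding[OF b(1)] by blast
    moreover from this have "\<forall>b\<in>B. avoids D b m' y"
      using B avoids_mono by blast
    ultimately show ?case
      using m over_trans[OF m x] by (intro exI[of _ m'] exI[of _ y]) auto
  qed
  from this[OF _ subset_refl] obtain m x where m: "m1 \<le> m" and x: "x \<in> over m1 x1 m"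
    and avoids: "\<And>b. b \<in> C D \<Longrightarrow> F D 0 unit_matrix b = 0 \<Longrightarrow> b \<notin> stabilizer m1 x1 D \<Longrightarrow> avoids D b m x"
    using finite by (auto simp: finite_subset)
  show thesis
  proof (rule that[OF over_X[OF x]])
    fix v y r
    assume y: "y \<in> over m x (m + v)" and r: "r \<in> C v" "F v 0 unit_matrix r = 0"
      and yr: "y + F v (m + v) (shift_rows m unit_matrix) r \<in> X (m + v)"
    have "F v D A r \<in> stabilizer m x D" for A
    proof (rule ccontr)
      assume A: "F v D A r \<notin> stabilizer m x D"
      have "F D 0 unit_matrix (F v D A r) = F v 0 unit_matrix r"
        by (rule comp_eq[OF r(1)]) simp
      then have "avoids D (F v D A r) m x"
        using A r closed stable[OF m x] by (intro avoids) auto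
      then show False
        using y r yr unfolding avoids_def by blast
    qed
    then show "r \<in> stabilizer m x v"
      by (rule stabilizer_determined[OF r(1)])
  qed
qed

end

text \<open>The functor is arbitrary in the induction on \<open>D\<close>, since the hypothesis is
  applied to the shifted functor \<open>shift_kernel m\<close> and to the image \<open>Y\<close> of
  the points over x. The fibres over \<open>Y\<close> all have the size of the stabilizer, so the
  exponents add.\<close>

theorem count_points_over_nonempty_set:
  assumes "functor_subset p D C F X" and "X m0 \<noteq> {}"
  shows "\<exists>m H f. H \<subseteq> X m \<and> H \<noteq> {} \<and> polynomial_sequence f \<and>
    (\<forall>n. card {y \<in> X (m + n). F (m + n) m unit_matrix y \<in> H} = p ^ f n)"
  using assms
proof (induction D arbitrary: C F X m0)
  case 0
  then interpret functor_subset p 0 C F X by simp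
  have C: "x = 0" if "x \<in> C n" for x n
    using degree[OF that, of "[]" n unit_matrix] unit[OF that] by simp
  obtain x0 where "x0 \<in> X m0"
    using "0.prems"(2) by blast
  have "0 \<in> X n" for n
    using X_closed[OF \<open>x0 \<in> X m0\<close>, of n unit_matrix]
      C[OF X_C[OF X_closed[OF \<open>x0 \<in> X m0\<close>, of n unit_matrix]]] by simp
  then have "X n = {0}" for n
    using C[OF X_C[of _ n]] by auto
  moreover from this have "{y \<in> X (m0 + n). F (m0 + n) m0 unit_matrix y \<in> X m0} = {0}" for n
    using zero by auto
  ultimately have "X m0 \<subseteq> X m0 \<and> X m0 \<noteq> {} \<and> polynomial_sequence (\<lambda>_. 0) \<and>
      (\<forall>n. card {y \<in> X (m0 + n). F (m0 + n) m0 unit_matrix y \<in> X m0} = p ^ 0)"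
    by (simp add: polynomial_sequence_const)
  then show ?case by blast
next
  case (Suc D)
  then interpret functor_subset p "Suc D" C F X by simp
  obtain x0 where "x0 \<in> X m0"
    using Suc.prems(2) by blast
  then obtain m x where x: "x \<in> X m"
    and coset: "\<And>v y r. y \<in> over m x (m + v) \<Longrightarrow> r \<in> C v \<Longrightarrow> F v 0 unit_matrix r = 0 \<Longrightarrow>
      y + F v (m + v) (shift_rows m unit_matrix) r \<in> X (m + v) \<Longrightarrow> r \<in> stabilizer m x v"
    using exists_point_with_coset_fibres by metis
  define pr where "pr v = F (m + v) v (shift_cols m unit_matrix)" for v
  define inc where "inc v = F v (m + v) (shift_rows m unit_matrix)" for v
  \<comment> \<open>With U = K^m and V = K^v, \<open>c v\<close> is the projection of P(U + V) onto
    \<open>shift_kernel m v\<close> along the summand P(V). It plays the role of the quotient map by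
    P(V).\<close>
  define c where "c v y = y - inc v (pr v y)" for v y
  define G where "G v w A = F (m + v) (m + w) (unit_block m A)" for v w A
  define Y where "Y v = c v ` over m x (m + v)" for v
  have pr_C: "pr v y \<in> C v" if "y \<in> C (m + v)" for v y
    using that closed by (simp add: pr_def)
  have inc_C: "inc v r \<in> C (m + v)" if "r \<in> C v" for v r
    using that closed by (simp add: inc_def)
  have pr_inc: "pr v (inc v r) = r" if "r \<in> C v" for v r
  proof -
    have "pr v (inc v r) = F v v unit_matrix r"
      unfolding pr_def inc_def using that
      by (rule comp_eq) (auto simp: matrix_prod_shift_cols_left matrix_prod_unit_left shift_rows_def)
    then show ?thesis
      using unit that by simp
  qed
  have c_kernel: "c v y \<in> shift_kernel m v" if "y \<in> C (m + v)" for v y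
  proof -
    have "pr v (c v y) = pr v y - pr v (inc v (pr v y))"
      using that pr_C inc_C by (simp add: c_def pr_def diff)
    then show ?thesis
      using that pr_C inc_C pr_inc by (auto simp: shift_kernel_def c_def diff_mem simp flip: pr_def)
  qed
  have c_natural: "c w (G v w A y) = G v w A (c v y)" if "y \<in> C (m + v)" for v w A y
  proof -
    \<comment> \<open>Both correction terms turn out to be the image \<open>e w\<close> of y under 0
      + A.\<close>
    define e where "e w = F (m + v) (m + w) (shift_rows m (shift_cols m A)) y" for w
    have "pr w (G v w A y) = F (m + v) w (shift_cols m A) y"
      unfolding pr_def G_def using that
      by (rule comp_eq) (auto simp: matrix_prod_shift_cols_left matrix_prod_unit_left unit_above_def)
    moreover have "inc w (F (m + v) w (shift_cols m A) y) = e w"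
      unfolding inc_def e_def using that
      by (rule comp_eq) (auto simp: matrix_prod_shift_rows shift_rows_def matrix_prod_unit_left)
    moreover have "inc v (pr v y) = F (m + v) (m + v) (shift_rows m (shift_cols m unit_matrix)) y"
      unfolding inc_def pr_def using that
      by (rule comp_eq) (auto simp: matrix_prod_shift_rows shift_rows_def matrix_prod_unit_left)
    moreover have "G v w A (F (m + v) (m + v) (shift_rows m (shift_cols m unit_matrix)) y) = e w"
      unfolding G_def e_def using that
      by (rule comp_eq)
         (auto simp: matrix_prod_shift_rows_right unit_above_def shift_rows_def shift_cols_def
           unit_matrix_def matrix_prod_shift_cols matrix_prod_unit_right matrix_prod_def)
    moreover have "G v w A (y - inc v (pr v y)) = G v w A y - G v w A (inc v (pr v y))"
      unfolding G_def using that pr_C inc_C by (intro diff) auto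
    ultimately show ?thesis
      by (simp add: c_def)
  qed
  have G_over: "G v w A y \<in> over m x (m + w)" if "y \<in> over m x (m + v)" for v w A y
  proof -
    have "F (m + w) m unit_matrix (G v w A y) = F (m + v) m unit_matrix y"
      unfolding G_def by (rule comp_eq[OF over_C[OF that]]) (simp add: matrix_prod_unit_left unit_above_def)
    then show ?thesis
      using that X_closed by (auto simp: over_def G_def)
  qed
  interpret Y: functor_subset p D "shift_kernel m" G Y
  proof (intro functor_subset.intro functor_subset_axioms.intro)
    show "matrix_functor p D (shift_kernel m) G"
      using shift_functor[of m] by (simp add: G_def[abs_def])
    show "Y n \<subseteq> shift_kernel m n" for n
      using c_kernel over_C by (auto simp: Y_def)
    show "G v w A y \<in> Y w" if "y \<in> Y v" for y v w A
      using that G_over over_C by (auto simp: Y_def simp flip: c_natural)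
  qed
  have "Y 0 \<noteq> {}"
    using over_self[OF x] by (auto simp: Y_def)
  from Suc.IH[OF Y.functor_subset_axioms this] obtain m2 H2 f2 where H2: "H2 \<subseteq> Y m2" "H2 \<noteq> {}" and f2: "polynomial_sequence f2"
    and card_H2: "\<And>n. card {y \<in> Y (m2 + n). G (m2 + n) m2 unit_matrix y \<in> H2} = p ^ f2 n"
    by (elim exE conjE) (rule; (assumption | erule spec))
  obtain g where g: "polynomial_sequence g" and card_stab: "\<And>v. card (stabilizer m x v) = p ^ g v"
    using card_matrix_functor[OF stabilizer_functor] by blast
  define H where "H = {y \<in> over m x (m + m2). c m2 y \<in> H2}"
  have fibre: "card {y' \<in> over m x (m + v). c v y' = c v y} = p ^ g v" if y: "y \<in> over m x (m + v)" for v y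
  proof -
    have "bij_betw (\<lambda>r. y + inc v r) (stabilizer m x v) {y' \<in> over m x (m + v). c v y' = c v y}"
    proof (rule bij_betw_byWitness[where f' = "\<lambda>y'. pr v (y' - y)"])
      show "\<forall>r\<in>stabilizer m x v. pr v (y + inc v r - y) = r"
        using subsetD[OF stabilizer_C[of m x v]] pr_inc by simp
      have preim: "y + inc v (pr v (y' - y)) = y'" "pr v (y' - y) \<in> stabilizer m x v"
        if y': "y' \<in> over m x (m + v)" "c v y' = c v y" for y'
      proof -
        have yC: "y \<in> C (m + v)" "y' \<in> C (m + v)"
          using y y' over_C by auto
        then have "pr v (y' - y) = pr v y' - pr v y"
          by (simp add: pr_def diff)
        moreover have "inc v (pr v y' - pr v y) = inc v (pr v y') - inc v (pr v y)"
          using yC pr_C by (simp add: inc_def diff)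
        ultimately have inc_diff: "inc v (pr v (y' - y)) = inc v (pr v y') - inc v (pr v y)"
          by simp
        show preim: "y + inc v (pr v (y' - y)) = y'"
          using y'(2) unfolding inc_diff c_def by (simp add: algebra_simps)
        \<comment> \<open>Any two maps to K^0 agree, so the value at K^0 can be computed through
          K^m. There y and y' both give x, hence their difference satisfies the condition at K^0
          that \<open>coset\<close> demands.\<close>
        have "F v 0 unit_matrix (pr v z) = F m 0 unit_matrix (F (m + v) m unit_matrix z)"
          if "z \<in> C (m + v)" for z
          using comp_eq[OF that, of 0 v _ _ unit_matrix] comp_eq[OF that, of 0 m _ _ unit_matrix]
          by (simp add: pr_def)
        then have "F v 0 unit_matrix (pr v y' - pr v y) = 0"
          using y y' yC pr_C by (simp add: diff over_def)
        then show "pr v (y' - y) \<in> stabilizer m x v"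
          using y y' yC preim over_X[OF y'(1)] pr_C \<open>pr v (y' - y) = pr v y' - pr v y\<close>
          by (intro coset[OF y]) (auto simp: diff_mem simp flip: inc_def)
      qed
      show "\<forall>y'\<in>{y' \<in> over m x (m + v). c v y' = c v y}. y + inc v (pr v (y' - y)) = y'"
        using preim by blast
      show "(\<lambda>y'. pr v (y' - y)) ` {y' \<in> over m x (m + v). c v y' = c v y} \<subseteq> stabilizer m x v"
        using preim by blast
      show "(\<lambda>r. y + inc v r) ` stabilizer m x v \<subseteq> {y' \<in> over m x (m + v). c v y' = c v y}"
      proof
        fix y' assume "y' \<in> (\<lambda>r. y + inc v r) ` stabilizer m x v"
        then obtain r where r: "r \<in> stabilizer m x v" "y' = y + inc v r"
          by blast
        have rC: "r \<in> C v" and yC: "y \<in> C (m + v)"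
          using r stabilizer_C over_C[OF y] by auto
        have "pr v y' = pr v y + r"
          using rC yC inc_C pr_inc by (simp add: r(2) pr_def add)
        moreover have "inc v (pr v y + r) = inc v (pr v y) + inc v r"
          unfolding inc_def using rC yC pr_C by (intro add) auto
        ultimately have "c v y' = c v y"
          by (simp add: c_def r(2))
        then show "y' \<in> {y' \<in> over m x (m + v). c v y' = c v y}"
          using over_add_stabilizer[OF y r(1)] by (simp add: r(2) inc_def)
      qed
    qed
    then show ?thesis
      using bij_betw_same_card card_stab by metis
  qed
  have "card {y \<in> X (m + m2 + n). F (m + m2 + n) (m + m2) unit_matrix y \<in> H} = p ^ (f2 n + g (m2 + n))" for n
  proof -
    \<comment> \<open>K^(m+m2+n) is read as K^m + K^v. Lying over \<open>H\<close> then combines two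
      conditions: lying over x, and having a \<open>c\<close>-image that lies over
      \<open>H2\<close>.\<close>
    define v where "v = m2 + n"
    define W where "W = {y \<in> Y v. G v m2 unit_matrix y \<in> H2}"
    define R where "R = {y \<in> over m x (m + v). c v y \<in> W}"
    have *: "F (m + v) (m + m2) unit_matrix y \<in> H \<longleftrightarrow> y \<in> R" if y: "y \<in> X (m + v)" for y
    proof -
      have G: "F (m + v) (m + m2) unit_matrix y = G v m2 unit_matrix y"
        unfolding G_def using X_C[OF y]
        by (intro cong) (auto simp: unit_above_def shift_cols_def unit_matrix_def)
      have "F (m + m2) m unit_matrix (F (m + v) (m + m2) unit_matrix y) = F (m + v) m unit_matrix y"
        by (rule comp_eq[OF X_C[OF y]]) (simp add: matrix_prod_unit_left)
      then show ?thesis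
        using y X_closed[OF y, of "m + m2" unit_matrix] c_natural[OF X_C[OF y], of m2 unit_matrix]
        by (auto simp: H_def R_def W_def over_def G Y_def)
    qed
    have "{y \<in> X (m + m2 + n). F (m + m2 + n) (m + m2) unit_matrix y \<in> H} = R"
      using * over_X by (auto simp: v_def add.assoc R_def)
    moreover have "card R = card (c v ` R) * p ^ g v"
    proof (rule card_equal_fibres)
      show "finite R"
        by (rule finite_subset[OF _ finite[of "m + v"]]) (auto simp: R_def over_C)
      fix z assume "z \<in> c v ` R"
      then obtain y where "y \<in> R" "z = c v y"
        by blast
      moreover from this have "{y' \<in> R. c v y' = z} = {y' \<in> over m x (m + v). c v y' = c v y}"
        by (auto simp: R_def)
      ultimately show "card {y' \<in> R. c v y' = z} = p ^ g v"
        using fibre by (simp add: R_def)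
    qed
    moreover have "c v ` R = W"
      by (auto simp: R_def W_def Y_def)
    ultimately show ?thesis
      using card_H2[of n] by (simp add: W_def v_def power_add)
  qed
  moreover have "polynomial_sequence (\<lambda>n. f2 n + g (m2 + n))"
    by (intro polynomial_sequence_add polynomial_sequence_shift f2 g)
  moreover have "H \<subseteq> X (m + m2)" "H \<noteq> {}"
    using H2 by (auto simp: H_def Y_def over_X)
  ultimately show ?case by blast
qed

section \<open>Rational numbers modulo one\<close>

text \<open>An ambient group that contains the additive group of every prime field.\<close>

quotient_type rat_mod_1 = rat / "\<lambda>x y. x - y \<in> \<int>"
proof (rule equivpI)
  show "reflp (\<lambda>x y :: rat. x - y \<in> \<int>)"
    by (simp add: reflp_def)
  show "symp (\<lambda>x y :: rat. x - y \<in> \<int>)"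
    unfolding symp_def by (metis Ints_minus minus_diff_eq)
  show "transp (\<lambda>x y :: rat. x - y \<in> \<int>)"
    unfolding transp_def by (metis Ints_add diff_add_cancel add_diff_eq)
qed

instantiation rat_mod_1 :: ab_group_add
begin

lift_definition zero_rat_mod_1 :: rat_mod_1 is 0 .

lift_definition plus_rat_mod_1 :: "rat_mod_1 \<Rightarrow> rat_mod_1 \<Rightarrow> rat_mod_1" is "(+)"
  by (metis Ints_add add_diff_add)

lift_definition uminus_rat_mod_1 :: "rat_mod_1 \<Rightarrow> rat_mod_1" is uminus
  by (metis Ints_minus minus_diff_minus)

definition minus_rat_mod_1 :: "rat_mod_1 \<Rightarrow> rat_mod_1 \<Rightarrow> rat_mod_1" where
  "minus_rat_mod_1 x y = x + - y"

instance
proof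
  fix a b c :: rat_mod_1
  show "a + b + c = a + (b + c)" by transfer (simp add: algebra_simps)
  show "a + b = b + a" by transfer (simp add: algebra_simps)
  show "0 + a = a" by transfer simp
  show "- a + a = 0" by transfer simp
  show "a - b = a + - b" by (simp add: minus_rat_mod_1_def)
qed

end

lift_definition fraction :: "nat \<Rightarrow> int \<Rightarrow> rat_mod_1" is "\<lambda>q a. of_int a / of_nat q" .

lemma fraction_add: "fraction q (a + b) = fraction q a + fraction q b"
  by transfer (simp add: add_divide_distrib)

lemma fraction_eq_iff:
  assumes "0 < q"
  shows "fraction q a = fraction q b \<longleftrightarrow> [a = b] (mod int q)"
proof -
  have "rat_of_int a / of_nat q - of_int b / of_nat q \<in> \<int> \<longleftrightarrow> int q dvd a - b"
  proof
    assume "rat_of_int a / of_nat q - of_int b / of_nat q \<in> \<int>"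
    then obtain k where "rat_of_int a / of_nat q - of_int b / of_nat q = of_int k"
      by (elim Ints_cases)
    then have "rat_of_int (a - b) = rat_of_int (int q * k)"
      using assms by (simp add: field_simps)
    then show "int q dvd a - b"
      by (simp only: of_int_eq_iff) simp
  next
    assume "int q dvd a - b"
    then obtain k where k: "a - b = int q * k" ..
    have "rat_of_int a / of_nat q - of_int b / of_nat q = of_int (a - b) / of_nat q"
      by (simp add: diff_divide_distrib)
    also have "\<dots> = of_int k"
      using assms by (simp add: k)
    finally show "rat_of_int a / of_nat q - of_int b / of_nat q \<in> \<int>"
      by simp
  qed
  then show ?thesis
    by transfer (simp add: cong_iff_dvd_diff)
qed

lemma fraction_zero: "fraction q 0 = 0"
  by transfer simp

lemma iter_diff_fraction: "iter_diff as (\<lambda>x. fraction q (g x)) x = fraction q (iter_diff as g x)"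
proof (induction as arbitrary: x)
  case (Cons a as)
  have "fraction q u - fraction q v = fraction q (u - v)" for u v
    using fraction_add[of q "u - v" v] by simp
  then show ?case
    by (simp add: Cons)
qed simp

section \<open>Vector spaces\<close>

lemma fd_vectorspace_finite:
  assumes "vectorspace K V" and "finite (carrier V)"
  shows "fd_vectorspace K V"
proof -
  interpret vectorspace K V by fact
  have "gen_set (carrier V)"
    using in_own_span[of "carrier V"] span_is_subset2[of "carrier V"] by auto
  then show ?thesis
    using assms by (auto simp: fd_vectorspace_def fin_dim_def)
qed

lemma image_module_simps:
  assumes "inj_on f (carrier V)"
  shows "carrier (image_module f V) = f ` carrier V"
    and "\<zero>\<^bsub>image_module f V\<^esub> = f \<zero>\<^bsub>V\<^esub>"
    and "x \<in> carrier V \<Longrightarrow> y \<in> carrier V \<Longrightarrow> f x \<oplus>\<^bsub>image_module f V\<^esub> f y = f (x \<oplus>\<^bsub>V\<^esub> y)"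
    and "x \<in> carrier V \<Longrightarrow> c \<odot>\<^bsub>image_module f V\<^esub> f x = f (c \<odot>\<^bsub>V\<^esub> x)"
  using assms by (auto simp: image_module_def Let_def)

lemma vectorspace_image_module:
  assumes "vectorspace K V" and f: "inj_on f (carrier V)"
  shows "vectorspace K (image_module f V)"
proof -
  interpret vectorspace K V by fact
  note simps = image_module_simps[OF f]
  have "module K (image_module f V)"
  proof (rule module_criteria)
    show "\<forall>v\<in>carrier (image_module f V). \<exists>w\<in>carrier (image_module f V).
        v \<oplus>\<^bsub>image_module f V\<^esub> w = \<zero>\<^bsub>image_module f V\<^esub>"
    proof
      fix v assume "v \<in> carrier (image_module f V)"
      then obtain x where x: "x \<in> carrier V" "v = f x"
        by (auto simp: simps)
      then show "\<exists>w\<in>carrier (image_module f V). v \<oplus>\<^bsub>image_module f V\<^esub> w = \<zero>\<^bsub>image_module f V\<^esub>"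
        by (intro bexI[of _ "f (\<ominus>\<^bsub>V\<^esub> x)"]) (auto simp: simps M.r_neg)
    qed
  qed (use is_cring in \<open>auto simp: simps M.a_ac smult_l_distr smult_r_distr smult_assoc1\<close>)
  then show ?thesis
    using assms(1) by (simp add: vectorspace_def)
qed

lemma HomD:
  assumes "f \<in> Hom K U V"
  shows "x \<in> carrier U \<Longrightarrow> f x \<in> carrier V"
    and "x \<in> carrier U \<Longrightarrow> y \<in> carrier U \<Longrightarrow> f (x \<oplus>\<^bsub>U\<^esub> y) = f x \<oplus>\<^bsub>V\<^esub> f y"
    and "c \<in> carrier K \<Longrightarrow> x \<in> carrier U \<Longrightarrow> f (c \<odot>\<^bsub>U\<^esub> x) = c \<odot>\<^bsub>V\<^esub> f x"
  using assms by (auto simp: Hom_space_def module_hom_def)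

lemma HomI:
  assumes "\<And>x. x \<in> carrier U \<Longrightarrow> f x \<in> carrier V"
    and "\<And>x y. x \<in> carrier U \<Longrightarrow> y \<in> carrier U \<Longrightarrow> f (x \<oplus>\<^bsub>U\<^esub> y) = f x \<oplus>\<^bsub>V\<^esub> f y"
    and "\<And>c x. c \<in> carrier K \<Longrightarrow> x \<in> carrier U \<Longrightarrow> f (c \<odot>\<^bsub>U\<^esub> x) = c \<odot>\<^bsub>V\<^esub> f x"
    and "f \<in> extensional (carrier U)"
  shows "f \<in> Hom K U V"
  using assms by (auto simp: Hom_space_def module_hom_def)

lemma Hom_extensional: "f \<in> Hom K U V \<Longrightarrow> f \<in> extensional (carrier U)"
  by (simp add: Hom_space_def)

lemma Hom_space_simps:
  shows "x \<in> carrier U \<Longrightarrow> (f \<oplus>\<^bsub>Hom_space K U V\<^esub> g) x = f x \<oplus>\<^bsub>V\<^esub> g x"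
    and "x \<in> carrier U \<Longrightarrow> (c \<odot>\<^bsub>Hom_space K U V\<^esub> f) x = c \<odot>\<^bsub>V\<^esub> f x"
    and "x \<in> carrier U \<Longrightarrow> \<zero>\<^bsub>Hom_space K U V\<^esub> x = \<zero>\<^bsub>V\<^esub>"
  by (auto simp: Hom_space_def)

lemma vectorspace_Hom_space:
  assumes "vectorspace K U" and "vectorspace K V"
  shows "vectorspace K (Hom_space K U V)"
proof -
  interpret U: vectorspace K U by fact
  interpret V: vectorspace K V by fact
  let ?H = "Hom_space K U V"
  have eqI: "f = g" if "f \<in> carrier ?H" "g \<in> carrier ?H" "\<And>x. x \<in> carrier U \<Longrightarrow> f x = g x" for f g
    using extensionalityI[OF Hom_extensional[OF that(1)] Hom_extensional[OF that(2)]] that(3) by blast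
  have zero: "\<zero>\<^bsub>?H\<^esub> \<in> carrier ?H"
    by (rule HomI) (auto simp: Hom_space_def)
  have add: "f \<oplus>\<^bsub>?H\<^esub> g \<in> carrier ?H" if "f \<in> carrier ?H" "g \<in> carrier ?H" for f g
  proof (rule HomI)
    show "f \<oplus>\<^bsub>?H\<^esub> g \<in> extensional (carrier U)"
      by (simp add: Hom_space_def)
  qed (use HomD[OF that(1)] HomD[OF that(2)] in
      \<open>auto simp: Hom_space_simps V.M.a_ac V.smult_r_distr\<close>)
  have smult: "c \<odot>\<^bsub>?H\<^esub> f \<in> carrier ?H" if "c \<in> carrier K" "f \<in> carrier ?H" for c f
  proof (rule HomI)
    show "c \<odot>\<^bsub>?H\<^esub> f \<in> extensional (carrier U)"
      by (simp add: Hom_space_def)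
  qed (use that HomD[OF that(2)] in
      \<open>auto simp: Hom_space_simps V.smult_r_distr simp flip: V.smult_assoc1 simp: U.m_comm\<close>)
  have "module K ?H"
  proof (rule module_criteria)
    show "\<forall>f\<in>carrier ?H. \<exists>g\<in>carrier ?H. f \<oplus>\<^bsub>?H\<^esub> g = \<zero>\<^bsub>?H\<^esub>"
    proof
      fix f assume f: "f \<in> carrier ?H"
      let ?g = "(\<ominus>\<^bsub>K\<^esub> \<one>\<^bsub>K\<^esub>) \<odot>\<^bsub>?H\<^esub> f"
      have "f \<oplus>\<^bsub>?H\<^esub> ?g = \<zero>\<^bsub>?H\<^esub>"
      proof (rule eqI)
        fix x assume "x \<in> carrier U"
        then show "(f \<oplus>\<^bsub>?H\<^esub> ?g) x = \<zero>\<^bsub>?H\<^esub> x"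
          using HomD(1)[OF f] by (simp add: Hom_space_simps V.smult_minus_1 V.M.r_neg)
      qed (use f add smult zero in auto)
      then show "\<exists>g\<in>carrier ?H. f \<oplus>\<^bsub>?H\<^esub> g = \<zero>\<^bsub>?H\<^esub>"
        using smult[OF _ f] by (intro bexI[of _ ?g]) auto
    qed
  qed (use U.is_cring in \<open>auto intro!: eqI zero add smult simp: Hom_space_simps HomD(1)
         V.M.a_ac V.smult_l_distr V.smult_r_distr V.smult_assoc1\<close>)
  then show ?thesis
    using assms(1) by (simp add: vectorspace_def)
qed

section \<open>Coordinates with respect to a finite basis\<close>

context
  fixes K :: "('k, 'm) ring_scheme" and V :: "('k, 'v) module" and B :: "'v set"
  assumes V: "vectorspace K V" and "finite B" and basis: "vectorspace.basis K V B"
begin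

interpretation vectorspace K V by (rule V)

lemma basis_subset: "B \<subseteq> carrier V"
  using basis by (simp add: basis_def)

lemma coordinates_unique:
  "v \<in> carrier V \<Longrightarrow> \<exists>!a. a \<in> B \<rightarrow>\<^sub>E carrier K \<and> lincomb a B = v"
  using basis basis_criterion[OF \<open>finite B\<close> basis_subset] by blast

lemma coordinates_spec:
  assumes "v \<in> carrier V"
  shows "coordinates K V B v \<in> B \<rightarrow>\<^sub>E carrier K" and "lincomb (coordinates K V B v) B = v"
  using theI'[OF coordinates_unique[OF assms]] by (auto simp: coordinates_def)

lemma coordinates_closed: "v \<in> carrier V \<Longrightarrow> b \<in> B \<Longrightarrow> coordinates K V B v b \<in> carrier K"
  using coordinates_spec(1) by blast

lemma coordinates_eqI:
  assumes "a \<in> B \<rightarrow> carrier K" "lincomb a B = v" "b \<in> B"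
  shows "coordinates K V B v b = a b"
proof -
  have v: "v \<in> carrier V"
    using assms basis_subset by auto
  have "lincomb (restrict a B) B = v"
    using assms basis_subset by (auto simp flip: assms(2) intro!: lincomb_cong)
  then have "coordinates K V B v = restrict a B"
    unfolding coordinates_def using assms(1) by (intro the1_equality[OF coordinates_unique[OF v]]) auto
  then show ?thesis
    using assms(3) by simp
qed

lemma coordinates_add:
  assumes "v \<in> carrier V" "w \<in> carrier V" "b \<in> B"
  shows "coordinates K V B (v \<oplus>\<^bsub>V\<^esub> w) b = coordinates K V B v b \<oplus>\<^bsub>K\<^esub> coordinates K V B w b"
proof (rule coordinates_eqI[OF _ _ assms(3)])
  have "coordinates K V B v \<in> B \<rightarrow> carrier K" "coordinates K V B w \<in> B \<rightarrow> carrier K"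
    using assms coordinates_closed by auto
  then show "lincomb (\<lambda>b. coordinates K V B v b \<oplus>\<^bsub>K\<^esub> coordinates K V B w b) B = v \<oplus>\<^bsub>V\<^esub> w"
    using lincomb_sum[OF \<open>finite B\<close> basis_subset] coordinates_spec(2) assms by simp
qed (use assms coordinates_closed in auto)

lemma coordinates_smult:
  assumes "v \<in> carrier V" "c \<in> carrier K" "b \<in> B"
  shows "coordinates K V B (c \<odot>\<^bsub>V\<^esub> v) b = c \<otimes>\<^bsub>K\<^esub> coordinates K V B v b"
proof (rule coordinates_eqI[OF _ _ assms(3)])
  have "coordinates K V B v \<in> B \<rightarrow> carrier K"
    using assms coordinates_closed by auto
  then show "lincomb (\<lambda>b. c \<otimes>\<^bsub>K\<^esub> coordinates K V B v b) B = c \<odot>\<^bsub>V\<^esub> v"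
    using lincomb_smult[OF basis_subset _ assms(2)] coordinates_spec(2) assms by simp
qed (use assms coordinates_closed in auto)

lemma coordinates_inj:
  assumes "v \<in> carrier V" "w \<in> carrier V"
    and "\<And>b. b \<in> B \<Longrightarrow> coordinates K V B v b = coordinates K V B w b"
  shows "v = w"
proof -
  have "coordinates K V B v = coordinates K V B w"
    using coordinates_spec(1)[OF assms(1)] coordinates_spec(1)[OF assms(2)] assms(3) by (rule PiE_ext)
  then show ?thesis
    using coordinates_spec(2) assms by metis
qed

lemma finite_carrier:
  assumes "finite (carrier K)"
  shows "finite (carrier V)"
proof (rule inj_on_finite)
  show "inj_on (coordinates K V B) (carrier V)"
    by (intro inj_onI coordinates_inj) simp_all
  show "coordinates K V B ` carrier V \<subseteq> B \<rightarrow>\<^sub>E carrier K"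
    using coordinates_spec by blast
  show "finite (B \<rightarrow>\<^sub>E carrier K)"
    using assms \<open>finite B\<close> by (intro finite_PiE) auto
qed

end

section \<open>Coordinate spaces over a prime field\<close>

locale prime_field = field K for K :: "('a, 'm) ring_scheme" (structure) +
  fixes q :: nat
  assumes finite_field: "finite (carrier K)" and card_field: "card (carrier K) = q" and prime: "prime q"
begin

definition of_integer :: "int \<Rightarrow> 'a" where
  "of_integer a = [a] \<cdot> \<one>"

lemma of_integer_closed: "of_integer a \<in> carrier K"
  by (simp add: of_integer_def)

lemma of_integer_add: "of_integer (a + b) = of_integer a \<oplus> of_integer b"
  by (simp add: of_integer_def add.int_pow_mult)

lemma of_integer_mult: "of_integer (a * b) = of_integer a \<otimes> of_integer b"
proof -
  have "of_integer a \<otimes> of_integer b = [b] \<cdot> ([a] \<cdot> \<one>)"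
    by (simp add: of_integer_def add_pow_rdistr_int)
  then show ?thesis
    by (simp add: of_integer_def add.int_pow_pow)
qed

lemma of_integer_0: "of_integer 0 = \<zero>"
  by (simp add: of_integer_def add_pow_int_ge)

lemma of_integer_1: "of_integer 1 = \<one>"
  by (simp add: of_integer_def add_pow_int_ge)

lemma of_integer_q: "of_integer (int q) = \<zero>"
proof -
  have "[order (add_monoid K)] \<cdot> \<one> = \<zero>"
    using add.pow_order_eq_1[OF one_closed] by simp
  then show ?thesis
    by (simp add: of_integer_def add_pow_int_ge order_def card_field)
qed

text \<open>The characteristic is q: the multiple q of 1 vanishes because q is the order of the
  additive group, and if a multiple c of 1 with c prime to q vanished, Bezout would give 1 =
  0.\<close>

lemma of_integer_eq_iff: "of_integer a = of_integer b \<longleftrightarrow> [a = b] (mod int q)"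
proof -
  have zero: "of_integer c = \<zero> \<longleftrightarrow> int q dvd c" for c
  proof
    assume "int q dvd c"
    then show "of_integer c = \<zero>"
      by (auto simp: dvd_def of_integer_mult of_integer_q of_integer_closed)
  next
    assume c: "of_integer c = \<zero>"
    show "int q dvd c"
    proof (rule ccontr)
      assume "\<not> int q dvd c"
      then have "coprime c (int q)"
        using prime by (metis coprime_commute prime_imp_coprime prime_nat_int_transfer)
      then obtain d where "[c * d = 1] (mod int q)"
        using cong_solve_coprime_int by blast
      then obtain k where "1 = c * d + int q * k"
        by (metis cong_iff_lin cong_sym)
      moreover have "of_integer (c * d + int q * k) = \<zero>"
        by (simp add: of_integer_add of_integer_mult of_integer_q c of_integer_closed)
      ultimately have "of_integer 1 = \<zero>"
        by metis
      then show False
        by (simp add: of_integer_1)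
    qed
  qed
  have "of_integer a = of_integer (a - b) \<oplus> of_integer b"
    by (simp flip: of_integer_add)
  then have "of_integer a = of_integer b \<longleftrightarrow> of_integer (a - b) = \<zero>"
    using add.l_cancel_one[of "of_integer b" "of_integer (a - b)"] of_integer_closed
    by (auto simp: a_comm)
  then show ?thesis
    by (simp add: zero cong_iff_dvd_diff)
qed

text \<open>There are q distinct images among q elements. Thus every scalar comes from an integer,
  which allows integers in place of scalars as entries and coordinates.\<close>

lemma of_integer_image: "of_integer ` {0..<int q} = carrier K"
proof (rule card_subset_eq[OF finite_field])
  have "inj_on of_integer {0..<int q}"
    by (intro inj_onI) (simp add: of_integer_eq_iff cong_def)
  then show "card (of_integer ` {0..<int q}) = card (carrier K)"
    by (simp add: card_image card_field)
qed (use of_integer_closed in auto)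

definition residue :: "'a \<Rightarrow> int" where
  "residue = inv_into {0..<int q} of_integer"

lemma of_integer_residue: "x \<in> carrier K \<Longrightarrow> of_integer (residue x) = x"
  unfolding residue_def by (rule f_inv_into_f) (simp add: of_integer_image)

lemma residue_eqI: "x \<in> carrier K \<Longrightarrow> of_integer a = x \<Longrightarrow> [residue x = a] (mod int q)"
  by (simp add: of_integer_residue flip: of_integer_eq_iff)

lemma residue_of_integer: "[residue (of_integer a) = a] (mod int q)"
  by (simp add: residue_eqI of_integer_closed)

lemma residue_cong_iff:
  "x \<in> carrier K \<Longrightarrow> y \<in> carrier K \<Longrightarrow> [residue x = residue y] (mod int q) \<longleftrightarrow> x = y"
  by (simp add: of_integer_residue flip: of_integer_eq_iff)

lemma residue_add:
  "x \<in> carrier K \<Longrightarrow> y \<in> carrier K \<Longrightarrow> [residue (x \<oplus> y) = residue x + residue y] (mod int q)"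
  by (intro residue_eqI) (auto simp: of_integer_add of_integer_residue)

lemma residue_mult:
  "x \<in> carrier K \<Longrightarrow> y \<in> carrier K \<Longrightarrow> [residue (x \<otimes> y) = residue x * residue y] (mod int q)"
  by (intro residue_eqI) (auto simp: of_integer_mult of_integer_residue)

lemma residue_power: "x \<in> carrier K \<Longrightarrow> [residue (x [^] (k::nat)) = residue x ^ k] (mod int q)"
proof (induction k)
  case 0
  then show ?case by (intro residue_eqI) (auto simp: of_integer_1)
next
  case (Suc k)
  have "[residue (x [^] k \<otimes> x) = residue (x [^] k) * residue x] (mod int q)"
    using Suc by (intro residue_mult) auto
  also have "[residue (x [^] k) * residue x = residue x ^ k * residue x] (mod int q)"
    using Suc by (intro cong_mult) auto
  finally show ?case
    by (simp add: mult.commute)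
qed

lemma residue_finsum:
  assumes "f \<in> I \<rightarrow> carrier K"
  shows "[residue (\<Oplus>i\<in>I. f i) = (\<Sum>i\<in>I. residue (f i))] (mod int q)"
  using assms
proof (induction I rule: infinite_finite_induct)
  case (insert i I)
  then have "[residue (f i \<oplus> (\<Oplus>i\<in>I. f i)) = residue (f i) + residue (\<Oplus>i\<in>I. f i)] (mod int q)"
    by (intro residue_add) auto
  also have "[residue (f i) + residue (\<Oplus>i\<in>I. f i) = residue (f i) + (\<Sum>i\<in>I. residue (f i))] (mod int q)"
    using insert by (intro cong_add) auto
  finally show ?case
    using insert by (simp add: finsum_insert)
qed (auto intro!: residue_eqI simp: of_integer_0)

lemma residue_finprod:
  assumes "f \<in> I \<rightarrow> carrier K"
  shows "[residue (\<Otimes>i\<in>I. f i) = (\<Prod>i\<in>I. residue (f i))] (mod int q)"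
  using assms
proof (induction I rule: infinite_finite_induct)
  case (insert i I)
  then have "[residue (f i \<otimes> (\<Otimes>i\<in>I. f i)) = residue (f i) * residue (\<Otimes>i\<in>I. f i)] (mod int q)"
    by (intro residue_mult) auto
  also have "[residue (f i) * residue (\<Otimes>i\<in>I. f i) = residue (f i) * (\<Prod>i\<in>I. residue (f i))] (mod int q)"
    using insert by (intro cong_mult) auto
  finally show ?case
    using insert by (simp add: finprod_insert)
qed (auto intro!: residue_eqI simp: of_integer_1)

definition entries :: "('a, 'e) elem \<Rightarrow> nat \<Rightarrow> 'a" where
  "entries x = (case x of Tuple t \<Rightarrow> t)"

lemma entries_Tuple [simp]: "entries (Tuple t) = t"
  by (simp add: entries_def)

lemma inj_Tuple: "inj_on Tuple A"
  by (auto intro: inj_onI)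

lemma coordinate_space_carrier:
  "carrier (coordinate_space K n) = Tuple ` ({..<n} \<rightarrow>\<^sub>E carrier K)"
  by (simp add: coordinate_space_def image_module_simps(1)[OF inj_Tuple] func_space_def)

lemma coordinate_space_add:
  "s \<in> {..<n} \<rightarrow>\<^sub>E carrier K \<Longrightarrow> t \<in> {..<n} \<rightarrow>\<^sub>E carrier K \<Longrightarrow>
    Tuple s \<oplus>\<^bsub>coordinate_space K n\<^esub> Tuple t = Tuple (\<lambda>i\<in>{..<n}. s i \<oplus> t i)"
  unfolding coordinate_space_def by (subst image_module_simps(3)[OF inj_Tuple]) (simp_all add: func_space_def)

lemma coordinate_space_smult:
  "t \<in> {..<n} \<rightarrow>\<^sub>E carrier K \<Longrightarrow>
    c \<odot>\<^bsub>coordinate_space K n\<^esub> Tuple t = Tuple (\<lambda>i\<in>{..<n}. c \<otimes> t i)"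
  unfolding coordinate_space_def by (subst image_module_simps(4)[OF inj_Tuple]) (simp_all add: func_space_def)

lemma vectorspace_coordinate_space: "vectorspace K (coordinate_space K n)"
  unfolding coordinate_space_def
  by (intro vectorspace_image_module inj_Tuple)
     (simp add: vectorspace_def func_space_is_module field_axioms)

lemma fd_coordinate_space: "fd_vectorspace K (coordinate_space K n)"
  by (intro fd_vectorspace_finite vectorspace_coordinate_space)
     (auto simp: coordinate_space_carrier intro!: finite_imageI finite_PiE finite_field)

definition linear :: "nat \<Rightarrow> nat \<Rightarrow> int_matrix \<Rightarrow> ('a, 'e) elem \<Rightarrow> ('a, 'e) elem" where
  "linear m n A = (\<lambda>x\<in>carrier (coordinate_space K m).
     Tuple (\<lambda>i\<in>{..<n}. of_integer (\<Sum>j<m. A i j * residue (entries x j))))"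

lemma linear_Tuple:
  "t \<in> {..<m} \<rightarrow>\<^sub>E carrier K \<Longrightarrow>
    linear m n A (Tuple t) = Tuple (\<lambda>i\<in>{..<n}. of_integer (\<Sum>j<m. A i j * residue (t j)))"
  by (simp add: linear_def coordinate_space_carrier)

lemma linear_Hom: "linear m n A \<in> Hom K (coordinate_space K m :: ('a, 'e) space) (coordinate_space K n)"
proof (rule HomI)
  fix x y :: "('a, 'e) elem" assume "x \<in> carrier (coordinate_space K m)" "y \<in> carrier (coordinate_space K m)"
  then obtain s t where st: "s \<in> {..<m} \<rightarrow>\<^sub>E carrier K" "t \<in> {..<m} \<rightarrow>\<^sub>E carrier K" "x = Tuple s" "y = Tuple t"
    by (auto simp: coordinate_space_carrier)
  have "[(\<Sum>j<m. A i j * residue (s j \<oplus> t j)) = (\<Sum>j<m. A i j * (residue (s j) + residue (t j)))] (mod int q)" for i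
    using st by (intro cong_sum cong_mult cong_refl residue_add) auto
  then have "of_integer (\<Sum>j<m. A i j * residue (s j \<oplus> t j)) =
      of_integer (\<Sum>j<m. A i j * residue (s j)) \<oplus> of_integer (\<Sum>j<m. A i j * residue (t j))" for i
    by (simp add: distrib_left sum.distrib of_integer_add flip: of_integer_eq_iff)
  moreover have "(\<lambda>i\<in>{..<m}. s i \<oplus> t i) \<in> {..<m} \<rightarrow>\<^sub>E carrier K"
    using st by auto
  ultimately show "linear m n A (x \<oplus>\<^bsub>coordinate_space K m\<^esub> y) =
      linear m n A x \<oplus>\<^bsub>coordinate_space K n\<^esub> linear m n A y"
    using st by (simp add: coordinate_space_add linear_Tuple of_integer_closed cong: restrict_cong)
next
  fix c and x :: "('a, 'e) elem" assume c: "c \<in> carrier K" and "x \<in> carrier (coordinate_space K m)"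
  then obtain t where t: "t \<in> {..<m} \<rightarrow>\<^sub>E carrier K" "x = Tuple t"
    by (auto simp: coordinate_space_carrier)
  have "[(\<Sum>j<m. A i j * residue (c \<otimes> t j)) = (\<Sum>j<m. A i j * (residue c * residue (t j)))] (mod int q)" for i
    using t c by (intro cong_sum cong_mult cong_refl residue_mult) auto
  moreover have "(\<Sum>j<m. A i j * (residue c * residue (t j))) = residue c * (\<Sum>j<m. A i j * residue (t j))" for i
    by (simp add: sum_distrib_left algebra_simps)
  ultimately have "of_integer (\<Sum>j<m. A i j * residue (c \<otimes> t j)) = c \<otimes> of_integer (\<Sum>j<m. A i j * residue (t j))" for i
    using c by (simp add: of_integer_mult of_integer_residue flip: of_integer_eq_iff)
  moreover have "(\<lambda>i\<in>{..<m}. c \<otimes> t i) \<in> {..<m} \<rightarrow>\<^sub>E carrier K"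
    using t c by auto
  ultimately show "linear m n A (c \<odot>\<^bsub>coordinate_space K m\<^esub> x) = c \<odot>\<^bsub>coordinate_space K n\<^esub> linear m n A x"
    using t by (simp add: coordinate_space_smult linear_Tuple of_integer_closed cong: restrict_cong)
qed (auto simp: coordinate_space_carrier linear_def of_integer_closed)

lemma linear_comp:
  "linear k n (matrix_prod m A B) = compose (carrier (coordinate_space K k :: ('a, 'e) space)) (linear m n A) (linear k m B)"
proof (rule extensionalityI)
  fix x :: "('a, 'e) elem" assume x: "x \<in> carrier (coordinate_space K k)"
  then obtain t where t: "t \<in> {..<k} \<rightarrow>\<^sub>E carrier K" "x = Tuple t"
    by (auto simp: coordinate_space_carrier)
  have "[(\<Sum>l<m. A i l * residue (of_integer (\<Sum>j<k. B l j * residue (t j)))) =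
      (\<Sum>l<m. A i l * (\<Sum>j<k. B l j * residue (t j)))] (mod int q)" for i
    by (intro cong_sum cong_mult cong_refl residue_of_integer)
  moreover have "(\<Sum>l<m. A i l * (\<Sum>j<k. B l j * residue (t j))) = (\<Sum>j<k. matrix_prod m A B i j * residue (t j))" for i
    unfolding matrix_prod_def sum_distrib_right sum_distrib_left
    by (subst sum.swap) (simp add: mult.assoc)
  ultimately have "of_integer (\<Sum>j<k. matrix_prod m A B i j * residue (t j)) =
      of_integer (\<Sum>l<m. A i l * residue (of_integer (\<Sum>j<k. B l j * residue (t j))))" for i
    by (simp add: of_integer_eq_iff cong_sym)
  moreover have "(\<lambda>i\<in>{..<m}. of_integer (\<Sum>j<k. B i j * residue (t j))) \<in> {..<m} \<rightarrow>\<^sub>E carrier K"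
    using of_integer_closed by auto
  ultimately show "linear k n (matrix_prod m A B) x = compose (carrier (coordinate_space K k)) (linear m n A) (linear k m B) x"
    using t x by (simp add: linear_Tuple compose_eq cong: restrict_cong)
qed (auto simp: linear_def compose_def)

lemma linear_unit: "linear n n unit_matrix = (\<lambda>x\<in>carrier (coordinate_space K n :: ('a, 'e) space). x)"
proof (rule extensionalityI)
  fix x :: "('a, 'e) elem" assume x: "x \<in> carrier (coordinate_space K n)"
  then obtain t where t: "t \<in> {..<n} \<rightarrow>\<^sub>E carrier K" "x = Tuple t"
    by (auto simp: coordinate_space_carrier)
  have "(\<Sum>j<n. unit_matrix i j * residue (t j)) = residue (t i)" if "i < n" for i
    using matrix_prod_unit_left[OF that, of "\<lambda>j _. residue (t j)"] by (simp add: matrix_prod_def)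
  then have "(\<lambda>i\<in>{..<n}. of_integer (\<Sum>j<n. unit_matrix i j * residue (t j))) = t"
    using t by (intro extensionalityI[of _ "{..<n}"]) (auto simp: of_integer_residue PiE_iff)
  then show "linear n n unit_matrix x = (\<lambda>x\<in>carrier (coordinate_space K n). x) x"
    using t x by (simp add: linear_Tuple)
qed (auto simp: linear_def)

lemma linear_cong:
  assumes "\<And>i j. i < n \<Longrightarrow> j < m \<Longrightarrow> A i j = B i j"
  shows "linear m n A = linear m n B"
  unfolding linear_def using assms
  by (intro restrict_ext arg_cong[where f = Tuple] arg_cong[where f = of_integer] sum.cong) auto

text \<open>Turns differences in the matrix into differences in the Hom space, where polynomiality
  of the representation is expressed.\<close>

lemma linear_add:
  "linear m n (A + B) =
    linear m n A \<oplus>\<^bsub>Hom_space K (coordinate_space K m :: ('a, 'e) space) (coordinate_space K n)\<^esub> linear m n B"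
proof (rule extensionalityI)
  fix x :: "('a, 'e) elem" assume x: "x \<in> carrier (coordinate_space K m)"
  then obtain t where t: "t \<in> {..<m} \<rightarrow>\<^sub>E carrier K" "x = Tuple t"
    by (auto simp: coordinate_space_carrier)
  have "(\<lambda>i\<in>{..<n}. of_integer (f i)) \<in> {..<n} \<rightarrow>\<^sub>E carrier K" for f
    using of_integer_closed by auto
  then show "linear m n (A + B) x =
      (linear m n A \<oplus>\<^bsub>Hom_space K (coordinate_space K m) (coordinate_space K n)\<^esub> linear m n B) x"
    using t x by (simp add: linear_Tuple Hom_space_simps coordinate_space_add distrib_right sum.distrib
        of_integer_add cong: restrict_cong)
qed (auto simp: linear_def Hom_space_def)

section \<open>Direct sums of coordinate spaces\<close>

lemma dsum_simps:
  shows "carrier (dsum U V) = (\<lambda>(u, v). Couple u v) ` (carrier U \<times> carrier V)"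
    and "u \<in> carrier U \<Longrightarrow> v \<in> carrier V \<Longrightarrow> u' \<in> carrier U \<Longrightarrow> v' \<in> carrier V \<Longrightarrow>
      Couple u v \<oplus>\<^bsub>dsum U V\<^esub> Couple u' v' = Couple (u \<oplus>\<^bsub>U\<^esub> u') (v \<oplus>\<^bsub>V\<^esub> v')"
    and "u \<in> carrier U \<Longrightarrow> v \<in> carrier V \<Longrightarrow>
      c \<odot>\<^bsub>dsum U V\<^esub> Couple u v = Couple (c \<odot>\<^bsub>U\<^esub> u) (c \<odot>\<^bsub>V\<^esub> v)"
proof -
  have inj: "inj_on (\<lambda>(u, v). Couple u v) (carrier (direct_sum U V))"
    by (auto intro: inj_onI)
  have mem: "(u, v) \<in> carrier (direct_sum U V) \<longleftrightarrow> u \<in> carrier U \<and> v \<in> carrier V" for u v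
    by (simp add: direct_sum_def)
  show "carrier (dsum U V) = (\<lambda>(u, v). Couple u v) ` (carrier U \<times> carrier V)"
    by (simp add: dsum_def image_module_simps(1)[OF inj]) (simp add: direct_sum_def)
  show "Couple u v \<oplus>\<^bsub>dsum U V\<^esub> Couple u' v' = Couple (u \<oplus>\<^bsub>U\<^esub> u') (v \<oplus>\<^bsub>V\<^esub> v')"
    if "u \<in> carrier U" "v \<in> carrier V" "u' \<in> carrier U" "v' \<in> carrier V"
    using image_module_simps(3)[OF inj, of "(u, v)" "(u', v')"] that
    by (simp add: mem dsum_def) (simp add: direct_sum_def)
  show "c \<odot>\<^bsub>dsum U V\<^esub> Couple u v = Couple (c \<odot>\<^bsub>U\<^esub> u) (c \<odot>\<^bsub>V\<^esub> v)"
    if "u \<in> carrier U" "v \<in> carrier V"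
    using image_module_simps(4)[OF inj, of "(u, v)" c] that
    by (simp add: mem dsum_def) (simp add: direct_sum_def)
qed

lemma vectorspace_dsum: "vectorspace K U \<Longrightarrow> vectorspace K V \<Longrightarrow> vectorspace K (dsum U V)"
  unfolding dsum_def by (intro vectorspace_image_module direct_sum_is_vs) (auto intro: inj_onI)

abbreviation sum_space :: "nat \<Rightarrow> nat \<Rightarrow> ('a, 'e) space" where
  "sum_space m n \<equiv> dsum (coordinate_space K m) (coordinate_space K n)"

lemma fd_sum_space: "fd_vectorspace K (sum_space m n)"
  by (intro fd_vectorspace_finite vectorspace_dsum vectorspace_coordinate_space)
     (auto simp: dsum_simps coordinate_space_carrier intro!: finite_imageI finite_cartesian_product finite_PiE finite_field)

lemma sum_spaceE:
  assumes "x \<in> carrier (sum_space m n)"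
  obtains s t where "s \<in> {..<m} \<rightarrow>\<^sub>E carrier K" "t \<in> {..<n} \<rightarrow>\<^sub>E carrier K" "x = Couple (Tuple s) (Tuple t)"
  using assms by (auto simp: dsum_simps coordinate_space_carrier)

text \<open>The shift of X is formed on couples, the matrix functor on K^(m+n); \<open>join\<close>
  and \<open>split\<close> are the mutually inverse isomorphisms between the two.\<close>

definition join :: "nat \<Rightarrow> nat \<Rightarrow> ('a, 'e) elem \<Rightarrow> ('a, 'e) elem" where
  "join m n = (\<lambda>x\<in>carrier (sum_space m n).
     Tuple (\<lambda>i\<in>{..<m + n}. if i < m then entries (left x) i else entries (right x) (i - m)))"

definition split :: "nat \<Rightarrow> nat \<Rightarrow> ('a, 'e) elem \<Rightarrow> ('a, 'e) elem" where
  "split m n = (\<lambda>x\<in>carrier (coordinate_space K (m + n)).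
     Couple (Tuple (\<lambda>i\<in>{..<m}. entries x i)) (Tuple (\<lambda>i\<in>{..<n}. entries x (m + i))))"

lemma Couple_sum_space:
  "s \<in> {..<m} \<rightarrow>\<^sub>E carrier K \<Longrightarrow> t \<in> {..<n} \<rightarrow>\<^sub>E carrier K \<Longrightarrow> Couple (Tuple s) (Tuple t) \<in> carrier (sum_space m n)"
  by (auto simp: dsum_simps coordinate_space_carrier)

lemma Tuple_space: "t \<in> {..<n} \<rightarrow>\<^sub>E carrier K \<Longrightarrow> Tuple t \<in> carrier (coordinate_space K n)"
  by (simp add: coordinate_space_carrier)

lemma join_Couple:
  "s \<in> {..<m} \<rightarrow>\<^sub>E carrier K \<Longrightarrow> t \<in> {..<n} \<rightarrow>\<^sub>E carrier K \<Longrightarrow>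
    join m n (Couple (Tuple s) (Tuple t)) = Tuple (\<lambda>i\<in>{..<m + n}. if i < m then s i else t (i - m))"
  by (simp add: join_def Couple_sum_space cong: if_cong)

lemma split_Tuple:
  "t \<in> {..<m + n} \<rightarrow>\<^sub>E carrier K \<Longrightarrow>
    split m n (Tuple t) = Couple (Tuple (\<lambda>i\<in>{..<m}. t i)) (Tuple (\<lambda>i\<in>{..<n}. t (m + i)))"
  by (simp add: split_def Tuple_space)

lemma append_space:
  fixes m n :: nat
  assumes "s \<in> {..<m} \<rightarrow>\<^sub>E carrier K" "t \<in> {..<n} \<rightarrow>\<^sub>E carrier K"
  shows "(\<lambda>i\<in>{..<m + n}. if i < m then s i else t (i - m)) \<in> {..<m + n} \<rightarrow>\<^sub>E carrier K"
proof -
  have "t (i - m) \<in> carrier K" if "i < m + n" "\<not> i < m" for i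
    using that by (intro PiE_mem[OF assms(2)]) auto
  then show ?thesis
    using assms(1) by (auto simp: PiE_iff)
qed

lemma split_spaces:
  fixes m n :: nat
  assumes "t \<in> {..<m + n} \<rightarrow>\<^sub>E carrier K"
  shows "(\<lambda>i\<in>{..<m}. t i) \<in> {..<m} \<rightarrow>\<^sub>E carrier K" "(\<lambda>i\<in>{..<n}. t (m + i)) \<in> {..<n} \<rightarrow>\<^sub>E carrier K"
  using assms by (auto simp: PiE_iff)

lemma pointwise_space:
  assumes "s \<in> {..<n} \<rightarrow>\<^sub>E carrier K" "t \<in> {..<n} \<rightarrow>\<^sub>E carrier K"
  shows "(\<lambda>i\<in>{..<n}. s i \<oplus> t i) \<in> {..<n} \<rightarrow>\<^sub>E carrier K"
  using assms by (auto simp: PiE_iff)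

lemma scaled_space:
  assumes "t \<in> {..<n} \<rightarrow>\<^sub>E carrier K" "c \<in> carrier K"
  shows "(\<lambda>i\<in>{..<n}. c \<otimes> t i) \<in> {..<n} \<rightarrow>\<^sub>E carrier K"
  using assms by (auto simp: PiE_iff)

lemma join_Hom: "join m n \<in> Hom K (sum_space m n :: ('a, 'e) space) (coordinate_space K (m + n))"
proof (rule HomI)
  fix x y :: "('a, 'e) elem" assume "x \<in> carrier (sum_space m n)" "y \<in> carrier (sum_space m n)"
  then obtain s t s' t' where st: "s \<in> {..<m} \<rightarrow>\<^sub>E carrier K" "t \<in> {..<n} \<rightarrow>\<^sub>E carrier K"
      "s' \<in> {..<m} \<rightarrow>\<^sub>E carrier K" "t' \<in> {..<n} \<rightarrow>\<^sub>E carrier K"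
      "x = Couple (Tuple s) (Tuple t)" "y = Couple (Tuple s') (Tuple t')"
    by (metis sum_spaceE)
  then show "join m n (x \<oplus>\<^bsub>sum_space m n\<^esub> y) = join m n x \<oplus>\<^bsub>coordinate_space K (m + n)\<^esub> join m n y"
    by (auto simp: dsum_simps Tuple_space coordinate_space_add join_Couple append_space pointwise_space
        simp del: restrict_PiE intro!: restrict_ext)
next
  fix c and x :: "('a, 'e) elem" assume "c \<in> carrier K" "x \<in> carrier (sum_space m n)"
  then obtain s t where "c \<in> carrier K" "s \<in> {..<m} \<rightarrow>\<^sub>E carrier K" "t \<in> {..<n} \<rightarrow>\<^sub>E carrier K"
      "x = Couple (Tuple s) (Tuple t)"
    by (metis sum_spaceE)
  then show "join m n (c \<odot>\<^bsub>sum_space m n\<^esub> x) = c \<odot>\<^bsub>coordinate_space K (m + n)\<^esub> join m n x"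
    by (auto simp: dsum_simps Tuple_space coordinate_space_smult join_Couple append_space scaled_space
        simp del: restrict_PiE intro!: restrict_ext)
qed (auto elim!: sum_spaceE simp: join_Couple append_space Tuple_space simp del: restrict_PiE, simp add: join_def)

lemma split_Hom: "split m n \<in> Hom K (coordinate_space K (m + n) :: ('a, 'e) space) (sum_space m n)"
proof (rule HomI)
  fix x y :: "('a, 'e) elem" assume "x \<in> carrier (coordinate_space K (m + n))" "y \<in> carrier (coordinate_space K (m + n))"
  then obtain s t where st: "s \<in> {..<m + n} \<rightarrow>\<^sub>E carrier K" "t \<in> {..<m + n} \<rightarrow>\<^sub>E carrier K"
      "x = Tuple s" "y = Tuple t"
    by (auto simp: coordinate_space_carrier)
  then show "split m n (x \<oplus>\<^bsub>coordinate_space K (m + n)\<^esub> y) = split m n x \<oplus>\<^bsub>sum_space m n\<^esub> split m n y"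
    by (simp add: coordinate_space_add pointwise_space split_Tuple split_spaces dsum_simps Tuple_space
        del: restrict_PiE cong: restrict_cong)
next
  fix c and x :: "('a, 'e) elem" assume "c \<in> carrier K" "x \<in> carrier (coordinate_space K (m + n))"
  then obtain t where "c \<in> carrier K" "t \<in> {..<m + n} \<rightarrow>\<^sub>E carrier K" "x = Tuple t"
    by (auto simp: coordinate_space_carrier)
  then show "split m n (c \<odot>\<^bsub>coordinate_space K (m + n)\<^esub> x) = c \<odot>\<^bsub>sum_space m n\<^esub> split m n x"
    by (simp add: coordinate_space_smult scaled_space split_Tuple split_spaces dsum_simps Tuple_space
        del: restrict_PiE cong: restrict_cong)
next
  fix x :: "('a, 'e) elem" assume "x \<in> carrier (coordinate_space K (m + n))"
  then obtain t where "t \<in> {..<m + n} \<rightarrow>\<^sub>E carrier K" "x = Tuple t"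
    by (auto simp: coordinate_space_carrier)
  then show "split m n x \<in> carrier (sum_space m n)"
    by (simp add: split_Tuple Couple_sum_space split_spaces del: restrict_PiE)
qed (simp add: split_def)

lemma split_join:
  "compose (carrier (sum_space m n :: ('a, 'e) space)) (split m n) (join m n) = (\<lambda>x\<in>carrier (sum_space m n). x)"
proof (rule extensionalityI)
  fix x :: "('a, 'e) elem" assume x: "x \<in> carrier (sum_space m n)"
  then obtain s t where st: "s \<in> {..<m} \<rightarrow>\<^sub>E carrier K" "t \<in> {..<n} \<rightarrow>\<^sub>E carrier K"
      "x = Couple (Tuple s) (Tuple t)"
    by (metis sum_spaceE)
  define u where "u = (\<lambda>i\<in>{..<m + n}. if i < m then s i else t (i - m))"
  have "(\<lambda>i\<in>{..<m}. u i) = s"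
    using st(1) by (intro extensionalityI[of _ "{..<m}"]) (auto simp: u_def PiE_iff)
  moreover have "(\<lambda>i\<in>{..<n}. u (m + i)) = t"
    using st(2) by (intro extensionalityI[of _ "{..<n}"]) (auto simp: u_def PiE_iff)
  ultimately show "compose (carrier (sum_space m n)) (split m n) (join m n) x = (\<lambda>x\<in>carrier (sum_space m n). x) x"
    using x st append_space[OF st(1,2)] by (simp add: compose_eq join_Couple split_Tuple del: restrict_PiE flip: u_def)
qed auto

lemma join_split:
  "compose (carrier (coordinate_space K (m + n) :: ('a, 'e) space)) (join m n) (split m n) = (\<lambda>x\<in>carrier (coordinate_space K (m + n)). x)"
proof (rule extensionalityI)
  fix x :: "('a, 'e) elem" assume x: "x \<in> carrier (coordinate_space K (m + n))"
  then obtain t where t: "t \<in> {..<m + n} \<rightarrow>\<^sub>E carrier K" "x = Tuple t"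
    by (auto simp: coordinate_space_carrier)
  have "(\<lambda>i\<in>{..<m + n}. if i < m then restrict t {..<m} i else (\<lambda>i\<in>{..<n}. t (m + i)) (i - m)) = t"
  proof (rule extensionalityI[of _ "{..<m + n}"])
    show "t \<in> extensional {..<m + n}"
      using t(1) by (simp add: PiE_iff)
    fix i assume i: "i \<in> {..<m + n}"
    show "(\<lambda>i\<in>{..<m + n}. if i < m then restrict t {..<m} i else (\<lambda>i\<in>{..<n}. t (m + i)) (i - m)) i = t i"
    proof (cases "i < m")
      case False
      then have "i - m < n"
        using i by auto
      then show ?thesis
        using i False by simp
    qed simp
  qed simp
  then show "compose (carrier (coordinate_space K (m + n))) (join m n) (split m n) x
      = (\<lambda>x\<in>carrier (coordinate_space K (m + n)). x) x"
    using x t by (simp add: compose_eq split_Tuple join_Couple split_spaces del: restrict_PiE)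
qed auto

lemma linear_unit_join:
  "compose (carrier (sum_space m n :: ('a, 'e) space)) (linear (m + n) m unit_matrix) (join m n)
    = proj_left (coordinate_space K m) (coordinate_space K n)"
proof (rule extensionalityI)
  fix x :: "('a, 'e) elem" assume x: "x \<in> carrier (sum_space m n)"
  then obtain s t where st: "s \<in> {..<m} \<rightarrow>\<^sub>E carrier K" "t \<in> {..<n} \<rightarrow>\<^sub>E carrier K"
      "x = Couple (Tuple s) (Tuple t)"
    by (metis sum_spaceE)
  define u where "u = (\<lambda>i\<in>{..<m + n}. if i < m then s i else t (i - m))"
  have "(\<Sum>j<m + n. unit_matrix i j * residue (u j)) = residue (u i)" if "i < m" for i
    using matrix_prod_unit_left[of i "m + n" "\<lambda>j _. residue (u j)"] that by (simp add: matrix_prod_def)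
  then have "(\<lambda>i\<in>{..<m}. of_integer (\<Sum>j<m + n. unit_matrix i j * residue (u j))) = s"
    using st by (intro extensionalityI[of _ "{..<m}"]) (auto simp: u_def of_integer_residue PiE_iff)
  then show "compose (carrier (sum_space m n)) (linear (m + n) m unit_matrix) (join m n) x
      = proj_left (coordinate_space K m) (coordinate_space K n) x"
    using x st append_space[OF st(1,2)]
    by (simp add: compose_eq join_Couple proj_left_def linear_Tuple del: restrict_PiE flip: u_def)
qed (auto simp: proj_left_def)

end

section \<open>The matrix functor of a polynomial generic representation\<close>

context prime_field
begin

text \<open>Applied to a coordinate of g y, as a functional of g in a Hom space, it converts the
  tensor expansion of the functor into a sum of integer products.\<close>

lemma residue_functional_finsum:
  assumes W: "vectorspace K W" and \<phi>: "\<And>v. v \<in> carrier W \<Longrightarrow> \<phi> v \<in> carrier K"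
    and add: "\<And>v w. v \<in> carrier W \<Longrightarrow> w \<in> carrier W \<Longrightarrow> \<phi> (v \<oplus>\<^bsub>W\<^esub> w) = \<phi> v \<oplus> \<phi> w"
    and smult: "\<And>c v. c \<in> carrier K \<Longrightarrow> v \<in> carrier W \<Longrightarrow> \<phi> (c \<odot>\<^bsub>W\<^esub> v) = c \<otimes> \<phi> v"
    and "\<And>i. i < k \<Longrightarrow> c i \<in> carrier K" and "\<And>i. i < k \<Longrightarrow> w i \<in> carrier W"
  shows "[residue (\<phi> (\<Oplus>\<^bsub>W\<^esub>i\<in>{..<k::nat}. c i \<odot>\<^bsub>W\<^esub> w i)) = (\<Sum>i<k. residue (c i) * residue (\<phi> (w i)))] (mod int q)"
  using assms(5-)
proof (induction k)
  case 0
  interpret W: vectorspace K W by (rule W)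
  have "\<phi> \<zero>\<^bsub>W\<^esub> = \<zero>"
    using smult[of \<zero> "\<zero>\<^bsub>W\<^esub>"] \<phi> by simp
  then show ?case
    by (simp add: residue_eqI of_integer_0)
next
  case (Suc k)
  interpret W: vectorspace K W by (rule W)
  let ?s = "\<Oplus>\<^bsub>W\<^esub>i\<in>{..<k}. c i \<odot>\<^bsub>W\<^esub> w i"
  have s: "?s \<in> carrier W"
    using Suc.prems by (intro W.M.finsum_closed) auto
  have "\<phi> (\<Oplus>\<^bsub>W\<^esub>i\<in>{..<Suc k}. c i \<odot>\<^bsub>W\<^esub> w i) = c k \<otimes> \<phi> (w k) \<oplus> \<phi> ?s"
    using Suc.prems s by (simp add: lessThan_Suc W.M.finsum_insert add smult Pi_def)
  moreover have "[residue (c k \<otimes> \<phi> (w k) \<oplus> \<phi> ?s) = residue (c k \<otimes> \<phi> (w k)) + residue (\<phi> ?s)] (mod int q)"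
    using Suc.prems s \<phi> by (intro residue_add) auto
  moreover have "[residue (c k \<otimes> \<phi> (w k)) + residue (\<phi> ?s) =
      residue (c k) * residue (\<phi> (w k)) + (\<Sum>i<k. residue (c i) * residue (\<phi> (w i)))] (mod int q)"
    using Suc \<phi> by (intro cong_add residue_mult) auto
  ultimately show ?case
    using cong_trans by (fastforce simp: add.commute)
qed

text \<open>The bound must not depend on m and n. A coordinate of \<open>linear m n A\<close> is
  additive in A, which gives the bound 2; its power with exponent a > 0 has bound 2a + 1, at most
  3a. A monomial thus costs at most 3d, plus 1 for the product and 1 for the coefficient.\<close>

lemma polynomial_function_degree:
  assumes f: "f \<in> polynomial_functions K
    (Hom_space K (coordinate_space K m :: ('a, 'e) space) (coordinate_space K n :: ('a, 'e) space)) d"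
  shows "degree_less q (3 * d + 2) (\<lambda>A. residue (f (linear m n A)))"
proof -
  let ?H = "Hom_space K (coordinate_space K m :: ('a, 'e) space) (coordinate_space K n :: ('a, 'e) space)"
  have H: "vectorspace K ?H"
    by (intro vectorspace_Hom_space vectorspace_coordinate_space)
  obtain B c where B: "finite B" "vectorspace.basis K ?H B" and c: "c \<in> exponents B d \<rightarrow> carrier K"
    and f_eq: "\<And>v. v \<in> carrier ?H \<Longrightarrow> f v = (\<Oplus>\<alpha>\<in>exponents B d. c \<alpha> \<otimes> (\<Otimes>b\<in>B. coordinates K ?H B v b [^] \<alpha> b))"
    using f unfolding polynomial_functions_def by blast
  define g where "g b A = residue (coordinates K ?H B (linear m n A) b)" for b A
  have closed: "coordinates K ?H B (linear m n A) b \<in> carrier K" if "b \<in> B" for A b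
    by (rule coordinates_closed[OF H B linear_Hom that])
  have g: "degree_less q 2 (g b)" if "b \<in> B" for b
  proof -
    have "[g b (A + A') = g b A + g b A'] (mod int q)" for A A'
      unfolding g_def linear_add coordinates_add[OF H B linear_Hom linear_Hom that]
      by (intro residue_add closed that)
    then have diff: "[g b (A + a) - g b A = g b a] (mod int q)" for A a
      by (simp add: cong_iff_dvd_diff diff_diff_add)
    have "degree_less q (Suc 0) (\<lambda>A. g b (A + a) - g b A)" for a
      by (rule degree_less_cong[OF degree_less_const cong_sym[OF diff]])
    then show ?thesis
      by (simp add: numeral_2_eq_2 degree_less_Suc)
  qed
  have "degree_less q (3 * d + 2) (\<lambda>A. residue (c \<alpha>) * (\<Prod>b\<in>B. g b A ^ \<alpha> b))" if \<alpha>: "\<alpha> \<in> exponents B d" for \<alpha>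
  proof -
    \<comment> \<open>A factor with exponent 0 would still cost 1 in
      \<open>degree_less_power\<close>, and the size of \<open>B\<close> grows with m and n; so such
      factors are dropped first.\<close>
    define S where "S = {b \<in> B. \<alpha> b \<noteq> 0}"
    have "(\<Prod>b\<in>B. g b A ^ \<alpha> b) = (\<Prod>b\<in>S. g b A ^ \<alpha> b)" for A
      by (rule prod.mono_neutral_right) (use B in \<open>auto simp: S_def\<close>)
    moreover have deg: "degree_less q (Suc (\<Sum>b\<in>S. Suc (\<alpha> b * 2))) (\<lambda>A. \<Prod>b\<in>S. g b A ^ \<alpha> b)"
      using B g by (intro degree_less_prod degree_less_power) (auto simp: S_def)
    moreover have "(\<Sum>b\<in>S. Suc (\<alpha> b * 2)) \<le> 3 * d"
    proof -
      have "(\<Sum>b\<in>S. Suc (\<alpha> b * 2)) \<le> (\<Sum>b\<in>S. 3 * \<alpha> b)"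
        by (rule sum_mono) (auto simp: S_def)
      also have "\<dots> \<le> (\<Sum>b\<in>B. 3 * \<alpha> b)"
        using B by (intro sum_mono2) (auto simp: S_def)
      also have "\<dots> \<le> 3 * d"
        using \<alpha> by (simp add: exponents_def flip: sum_distrib_left)
      finally show ?thesis .
    qed
    ultimately have "degree_less q (Suc (3 * d)) (\<lambda>A. \<Prod>b\<in>B. g b A ^ \<alpha> b)"
      using degree_less_mono[OF deg, of "Suc (3 * d)"] by simp
    from degree_less_mult[OF degree_less_const this] show ?thesis
      by simp
  qed
  then have "degree_less q (3 * d + 2) (\<lambda>A. \<Sum>\<alpha>\<in>exponents B d. residue (c \<alpha>) * (\<Prod>b\<in>B. g b A ^ \<alpha> b))"
    by (rule degree_less_sum)
  moreover have "[(\<Sum>\<alpha>\<in>exponents B d. residue (c \<alpha>) * (\<Prod>b\<in>B. g b A ^ \<alpha> b)) = residue (f (linear m n A))] (mod int q)" for A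
  proof -
    let ?x = "\<lambda>b. coordinates K ?H B (linear m n A) b"
    let ?p = "\<lambda>\<alpha>. \<Otimes>b\<in>B. ?x b [^] (\<alpha> b :: nat)"
    have p: "?p \<alpha> \<in> carrier K" for \<alpha>
      using closed by (intro finprod_closed) auto
    have "[residue (f (linear m n A)) = (\<Sum>\<alpha>\<in>exponents B d. residue (c \<alpha> \<otimes> ?p \<alpha>))] (mod int q)"
      unfolding f_eq[OF linear_Hom] using c p by (intro residue_finsum) auto
    also have "[(\<Sum>\<alpha>\<in>exponents B d. residue (c \<alpha> \<otimes> ?p \<alpha>)) =
        (\<Sum>\<alpha>\<in>exponents B d. residue (c \<alpha>) * residue (?p \<alpha>))] (mod int q)"
      using c p by (intro cong_sum residue_mult) auto
    also have "[(\<Sum>\<alpha>\<in>exponents B d. residue (c \<alpha>) * residue (?p \<alpha>)) =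
        (\<Sum>\<alpha>\<in>exponents B d. residue (c \<alpha>) * (\<Prod>b\<in>B. g b A ^ \<alpha> b))] (mod int q)"
    proof (intro cong_sum cong_mult cong_refl)
      fix \<alpha>
      have "[residue (?p \<alpha>) = (\<Prod>b\<in>B. residue (?x b [^] \<alpha> b))] (mod int q)"
        using closed by (intro residue_finprod) auto
      also have "[(\<Prod>b\<in>B. residue (?x b [^] \<alpha> b)) = (\<Prod>b\<in>B. g b A ^ \<alpha> b)] (mod int q)"
        unfolding g_def using closed by (intro cong_prod residue_power) auto
      finally show "[residue (?p \<alpha>) = (\<Prod>b\<in>B. g b A ^ \<alpha> b)] (mod int q)" .
    qed
    finally show ?thesis
      by (rule cong_sym)
  qed
  ultimately show ?thesis
    by (rule degree_less_cong)
qed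

end

locale prime_field_representation =
  prime_field K q + polynomial_generic_representation K P Pm
  for K :: "('k, 'm) ring_scheme" (structure) and q
    and P :: "('k, 'a) space \<Rightarrow> ('k, 'w) module"
    and Pm :: "('k, 'a) space \<Rightarrow> ('k, 'a) space
                 \<Rightarrow> (('k, 'a) elem \<Rightarrow> ('k, 'a) elem) \<Rightarrow> ('w \<Rightarrow> 'w)"
begin

abbreviation S :: "nat \<Rightarrow> ('k, 'a) space" where
  "S n \<equiv> coordinate_space K n"

definition chosen_basis :: "nat \<Rightarrow> 'w set" where
  "chosen_basis n = (SOME B. finite B \<and> vectorspace.basis K (P (S n)) B)"

lemma vectorspace_P: "fd_vectorspace K V \<Longrightarrow> vectorspace K (P V)"
  using object by (simp add: fd_vectorspace_def)

lemmas vectorspace_PS = vectorspace_P[OF fd_coordinate_space]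

lemma chosen_basis: "finite (chosen_basis n)" "vectorspace.basis K (P (S n)) (chosen_basis n)"
proof -
  interpret vectorspace K "P (S n)" by (rule vectorspace_PS)
  have "fin_dim"
    using object[OF fd_coordinate_space] by (simp add: fd_vectorspace_def)
  then have "finite (chosen_basis n) \<and> vectorspace.basis K (P (S n)) (chosen_basis n)"
    unfolding chosen_basis_def by (rule someI_ex[OF finite_basis_exists])
  then show "finite (chosen_basis n)" "vectorspace.basis K (P (S n)) (chosen_basis n)"
    by auto
qed

abbreviation coord :: "nat \<Rightarrow> 'w \<Rightarrow> 'w \<Rightarrow> 'k" where
  "coord n \<equiv> coordinates K (P (S n)) (chosen_basis n)"

lemmas coord_closed = coordinates_closed[OF vectorspace_PS chosen_basis]
  and coord_add = coordinates_add[OF vectorspace_PS chosen_basis]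
  and coord_smult = coordinates_smult[OF vectorspace_PS chosen_basis]
  and coord_inj = coordinates_inj[OF vectorspace_PS chosen_basis]
  and finite_PS = finite_carrier[OF vectorspace_PS chosen_basis finite_field]

text \<open>The spaces \<open>P (S n)\<close> are records without type class structure, whereas a
  matrix functor takes its values in one type of class \<open>ab_group_add\<close>. Coordinates
  divided by q, as functions on \<open>'w\<close> with zeros off the basis, put them all into one
  such group.\<close>

definition embed :: "nat \<Rightarrow> 'w \<Rightarrow> 'w \<Rightarrow> rat_mod_1" where
  "embed n x b = (if b \<in> chosen_basis n then fraction q (residue (coord n x b)) else 0)"

lemma embed_add:
  assumes "x \<in> carrier (P (S n))" "y \<in> carrier (P (S n))"
  shows "embed n (x \<oplus>\<^bsub>P (S n)\<^esub> y) = embed n x + embed n y"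
proof
  fix b
  have "fraction q (residue (coord n (x \<oplus>\<^bsub>P (S n)\<^esub> y) b)) = fraction q (residue (coord n x b) + residue (coord n y b))"
    if "b \<in> chosen_basis n"
    unfolding coord_add[OF assms that] using assms that prime_gt_0_nat[OF prime]
    by (simp add: fraction_eq_iff residue_add coord_closed)
  then show "embed n (x \<oplus>\<^bsub>P (S n)\<^esub> y) b = (embed n x + embed n y) b"
    by (simp add: embed_def fraction_add)
qed

lemma embed_inj: "inj_on (embed n) (carrier (P (S n)))"
proof (rule inj_onI)
  fix x y assume xy: "x \<in> carrier (P (S n))" "y \<in> carrier (P (S n))" and eq: "embed n x = embed n y"
  show "x = y"
  proof (rule coord_inj[OF xy])
    fix b assume b: "b \<in> chosen_basis n"
    then have "fraction q (residue (coord n x b)) = fraction q (residue (coord n y b))"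
      using fun_cong[OF eq, of b] by (simp add: embed_def)
    then show "coord n x b = coord n y b"
      using xy b prime_gt_0_nat[OF prime] by (simp add: fraction_eq_iff residue_cong_iff coord_closed)
  qed
qed

definition unembed :: "nat \<Rightarrow> ('w \<Rightarrow> rat_mod_1) \<Rightarrow> 'w" where
  "unembed n = inv_into (carrier (P (S n))) (embed n)"

lemma unembed_embed: "x \<in> carrier (P (S n)) \<Longrightarrow> unembed n (embed n x) = x"
  unfolding unembed_def by (rule inv_into_f_f[OF embed_inj])

definition value_set :: "nat \<Rightarrow> ('w \<Rightarrow> rat_mod_1) set" where
  "value_set n = embed n ` carrier (P (S n))"

definition transport :: "nat \<Rightarrow> nat \<Rightarrow> int_matrix \<Rightarrow> ('w \<Rightarrow> rat_mod_1) \<Rightarrow> 'w \<Rightarrow> rat_mod_1" where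
  "transport m n A y = embed n (Pm (S m) (S n) (linear m n A) (unembed m y))"

lemma Pm_linear: "Pm (S m) (S n) (linear m n A) \<in> Hom K (P (S m)) (P (S n))"
  by (intro morphism fd_coordinate_space linear_Hom)

lemma Pm_compose:
  assumes "fd_vectorspace K U" "fd_vectorspace K V" "fd_vectorspace K W"
    and "\<phi> \<in> Hom K U V" "\<psi> \<in> Hom K V W" "x \<in> carrier (P U)"
  shows "Pm U W (compose (carrier U) \<psi> \<phi>) x = Pm V W \<psi> (Pm U V \<phi> x)"
  using composition[OF assms(1-5)] assms(6) by (simp add: compose_eq)

lemma Pm_identity:
  "fd_vectorspace K V \<Longrightarrow> x \<in> carrier (P V) \<Longrightarrow> Pm V V (\<lambda>v\<in>carrier V. v) x = x"
  by (simp add: identity)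

lemma transport_embed:
  "x \<in> carrier (P (S m)) \<Longrightarrow> transport m n A (embed m x) = embed n (Pm (S m) (S n) (linear m n A) x)"
  by (simp add: transport_def unembed_embed)

lemma coord_degree:
  obtains d where "\<And>m n y b. y \<in> carrier (P (S m)) \<Longrightarrow> b \<in> chosen_basis n \<Longrightarrow>
    degree_less q (3 * d + 3) (\<lambda>A. residue (coord n (Pm (S m) (S n) (linear m n A) y) b))"
proof -
  obtain d where d: "\<And>U V. fd_vectorspace K U \<Longrightarrow> fd_vectorspace K V \<Longrightarrow>
      Pm U V \<in> polynomial_maps K (Hom_space K U V) (Hom_space K (P U) (P V)) d"
    using polynomial by blast
  have "degree_less q (3 * d + 3) (\<lambda>A. residue (coord n (Pm (S m) (S n) (linear m n A) y) b))"
    if y: "y \<in> carrier (P (S m))" and b: "b \<in> chosen_basis n" for m n y b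
  proof -
    let ?W = "Hom_space K (P (S m)) (P (S n))"
    define \<phi> where "\<phi> g = coord n (g y) b" for g
    obtain k :: nat and f w where fw: "\<And>i. i < k \<Longrightarrow> f i \<in> polynomial_functions K (Hom_space K (S m) (S n)) d"
      "\<And>i. i < k \<Longrightarrow> w i \<in> carrier ?W"
      and Pm: "\<And>v. v \<in> Hom K (S m) (S n) \<Longrightarrow> Pm (S m) (S n) v = (\<Oplus>\<^bsub>?W\<^esub>i\<in>{..<k}. f i v \<odot>\<^bsub>?W\<^esub> w i)"
      using d[OF fd_coordinate_space fd_coordinate_space, of m n] unfolding polynomial_maps_def by blast
    have f_closed: "f i (linear m n A) \<in> carrier K" if "i < k" for i A
      using fw(1)[OF that] linear_Hom[of m n A] by (auto simp: polynomial_functions_def functions_on_def)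
    \<comment> \<open>One more than in \<open>polynomial_function_degree\<close>, for the constant
      factor contributed by \<open>w i\<close>.\<close>
    have "degree_less q (3 * d + 3) (\<lambda>A. \<Sum>i<k. residue (f i (linear m n A)) * residue (\<phi> (w i)))"
      using degree_less_mult[OF polynomial_function_degree[OF fw(1)] degree_less_const]
      by (intro degree_less_sum) (simp add: numeral_3_eq_3)
    moreover have "[(\<Sum>i<k. residue (f i (linear m n A)) * residue (\<phi> (w i))) =
        residue (\<phi> (Pm (S m) (S n) (linear m n A)))] (mod int q)" for A
      unfolding Pm[OF linear_Hom]
    proof (rule cong_sym, rule residue_functional_finsum[where \<phi> = \<phi>])
      show "vectorspace K ?W"
        by (intro vectorspace_Hom_space vectorspace_PS)
    qed (use y b f_closed fw(2) in \<open>auto simp: \<phi>_def Hom_space_simps coord_closed coord_add coord_smult HomD(1)\<close>)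
    ultimately show ?thesis
      unfolding \<phi>_def by (rule degree_less_cong)
  qed
  then show thesis
    using that by blast
qed

lemma matrix_functor_value_set:
  obtains D where "matrix_functor q D value_set transport"
proof -
  obtain d where d: "\<And>m n y b. y \<in> carrier (P (S m)) \<Longrightarrow> b \<in> chosen_basis n \<Longrightarrow>
    degree_less q (3 * d + 3) (\<lambda>A. residue (coord n (Pm (S m) (S n) (linear m n A) y) b))"
    by (rule coord_degree) blast
  have "matrix_functor q (3 * d + 3) value_set transport"
  proof
    fix n
    interpret V: vectorspace K "P (S n)" by (rule vectorspace_PS)
    have "embed n \<zero>\<^bsub>P (S n)\<^esub> = 0"
      using embed_add[of "\<zero>\<^bsub>P (S n)\<^esub>" n "\<zero>\<^bsub>P (S n)\<^esub>"] by simp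
    then show "0 \<in> value_set n"
      unfolding value_set_def by (metis V.M.zero_closed image_eqI)
    show "finite (value_set n)"
      unfolding value_set_def using finite_PS by (rule finite_imageI)
    show "x - y \<in> value_set n" if xy: "x \<in> value_set n" "y \<in> value_set n" for x y
    proof -
      obtain u v where uv: "u \<in> carrier (P (S n))" "v \<in> carrier (P (S n))" "x = embed n u" "y = embed n v"
        using xy by (auto simp: value_set_def)
      have "(u \<ominus>\<^bsub>P (S n)\<^esub> v) \<oplus>\<^bsub>P (S n)\<^esub> v = u"
        using uv by (simp add: a_minus_def V.M.a_assoc V.M.l_neg)
      then have "embed n (u \<ominus>\<^bsub>P (S n)\<^esub> v) + y = x"
        using uv embed_add[of "u \<ominus>\<^bsub>P (S n)\<^esub> v" n v] by simp
      then have "x - y = embed n (u \<ominus>\<^bsub>P (S n)\<^esub> v)"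
        by (simp add: algebra_simps)
      then show ?thesis
        using uv by (simp add: value_set_def)
    qed
    show "\<exists>L. coordinate_system q (value_set n) L"
    proof
      show "coordinate_system q (value_set n) ((\<lambda>b y. residue (coord n (unembed n y) b)) ` chosen_basis n)"
        unfolding coordinate_system_def additive_mod_def
        by (auto simp: chosen_basis(1) value_set_def unembed_embed residue_add coord_add coord_closed
            residue_cong_iff coord_inj simp flip: embed_add intro!: arg_cong[where f = "embed n"] intro: coord_inj)
    qed
    show "transport n n unit_matrix x = x" if "x \<in> value_set n" for x
      using that by (auto simp: value_set_def transport_embed linear_unit Pm_identity fd_coordinate_space)
  next
    fix m n A and x assume x: "x \<in> value_set m"
    then obtain u where u: "u \<in> carrier (P (S m))" "x = embed m u"
      by (auto simp: value_set_def)
    show "transport m n A x \<in> value_set n"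
      using u HomD(1)[OF Pm_linear] by (simp add: transport_embed value_set_def)
    show "transport m n A x = transport m n B x" if "\<And>i j. i < n \<Longrightarrow> j < m \<Longrightarrow> A i j = B i j" for B
      by (simp add: transport_def linear_cong[OF that])
    show "transport m n A (x + y) = transport m n A x + transport m n A y" if y: "y \<in> value_set m" for y
    proof -
      obtain v where v: "v \<in> carrier (P (S m))" "y = embed m v"
        using y by (auto simp: value_set_def)
      interpret vectorspace K "P (S m)" by (rule vectorspace_PS)
      show ?thesis
        using u v HomD(1,2)[OF Pm_linear]
        by (simp add: transport_embed M.a_closed flip: embed_add)
    qed
    show "iter_diff as (\<lambda>A. transport m n A x) B = 0" if "length as = 3 * d + 3" for as B
    proof
      fix b
      have "iter_diff as (\<lambda>A. transport m n A x) B b = iter_diff as (\<lambda>A. transport m n A x b) B"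
        by (induction as arbitrary: B) auto
      also have "\<dots> = 0"
      proof (cases "b \<in> chosen_basis n")
        case True
        \<comment> \<open>Differences are known only modulo q; division by q in the rationals modulo
          one turns this into exact vanishing.\<close>
        have "int q dvd iter_diff as (\<lambda>A. residue (coord n (Pm (S m) (S n) (linear m n A) u) b)) B"
          using d[OF u(1) True] that by (simp add: degree_less_def)
        then have "fraction q (iter_diff as (\<lambda>A. residue (coord n (Pm (S m) (S n) (linear m n A) u) b)) B) = fraction q 0"
          using prime_gt_0_nat[OF prime] by (simp add: fraction_eq_iff cong_iff_dvd_diff)
        then show ?thesis
          using True by (simp add: u transport_embed embed_def iter_diff_fraction fraction_zero)
      next
        case False
        then show ?thesis
          by (simp add: u transport_embed embed_def iter_diff_zero)
      qed
      finally show "iter_diff as (\<lambda>A. transport m n A x) B b = 0 b"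
        by simp
    qed
  next
    fix k m n A B and x assume "x \<in> value_set k"
    then obtain u where u: "u \<in> carrier (P (S k))" "x = embed k u"
      by (auto simp: value_set_def)
    then show "transport m n A (transport k m B x) = transport k n (matrix_prod m A B) x"
      using Pm_compose[OF fd_coordinate_space fd_coordinate_space fd_coordinate_space linear_Hom linear_Hom]
        HomD(1)[OF Pm_linear]
      by (simp add: transport_embed linear_comp)
  qed (rule prime)
  then show thesis
    by (rule that)
qed

lemma Pm_join_split:
  "x \<in> carrier (P (S (m + n))) \<Longrightarrow>
    Pm (sum_space m n) (S (m + n)) (join m n) (Pm (S (m + n)) (sum_space m n) (split m n) x) = x"
  by (simp add: join_split Pm_identity fd_coordinate_space
      flip: Pm_compose[OF fd_coordinate_space fd_sum_space fd_coordinate_space split_Hom join_Hom])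

lemma Pm_split_join:
  "x \<in> carrier (P (sum_space m n)) \<Longrightarrow>
    Pm (S (m + n)) (sum_space m n) (split m n) (Pm (sum_space m n) (S (m + n)) (join m n) x) = x"
  by (simp add: split_join Pm_identity fd_sum_space
      flip: Pm_compose[OF fd_sum_space fd_coordinate_space fd_sum_space join_Hom split_Hom])

lemma Pm_proj_left:
  "x \<in> carrier (P (sum_space m n)) \<Longrightarrow>
    Pm (sum_space m n) (S m) (proj_left (S m) (S n)) x
    = Pm (S (m + n)) (S m) (linear (m + n) m unit_matrix) (Pm (sum_space m n) (S (m + n)) (join m n) x)"
  by (simp add: linear_unit_join
      flip: Pm_compose[OF fd_sum_space fd_coordinate_space fd_coordinate_space join_Hom linear_Hom])

theorem count_shifted_subset:
  assumes X: "is_subset K P Pm X" and "nonempty_subset K X"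
  shows "\<exists>U h A. fd_vectorspace K U \<and> h \<in> functions_on K (P U) \<and> (\<exists>p\<in>X U. h p \<noteq> \<zero>) \<and>
    (\<forall>n. finite (Sh_localized K Pm U X h (S n)) \<and>
      real (card (Sh_localized K Pm U X h (S n))) = real q powr real_of_rat (poly A (of_nat n)))"
proof -
  have X_carrier: "x \<in> carrier (P V)" if "fd_vectorspace K V" "x \<in> X V" for V x
    using X that unfolding is_subset_def by blast
  have X_closed: "Pm V W \<phi> x \<in> X W"
    if "fd_vectorspace K V" "fd_vectorspace K W" "\<phi> \<in> Hom K V W" "x \<in> X V" for V W \<phi> x
    using X that unfolding is_subset_def by blast
  define Y where "Y n = embed n ` X (S n)" for n
  obtain D where "matrix_functor q D value_set transport"
    by (rule matrix_functor_value_set)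
  then interpret Y: functor_subset q D value_set transport Y
  proof (intro functor_subset.intro functor_subset_axioms.intro)
    show "Y n \<subseteq> value_set n" for n
      using X_carrier[OF fd_coordinate_space] by (auto simp: Y_def value_set_def)
    show "transport m n A y \<in> Y n" if "y \<in> Y m" for m n A y
      using that X_closed[OF fd_coordinate_space fd_coordinate_space linear_Hom] X_carrier[OF fd_coordinate_space]
      by (auto simp: Y_def transport_embed)
  qed
  have "Y 0 \<noteq> {}"
  proof -
    obtain V x where V: "fd_vectorspace K V" "x \<in> X V"
      using \<open>nonempty_subset K X\<close> unfolding nonempty_subset_def by blast
    \<comment> \<open>The given point may lie over a space V that is not a coordinate space; the
      zero map carries it to K^0.\<close>
    have "\<zero>\<^bsub>Hom_space K V (S 0)\<^esub> \<in> Hom K V (S 0)"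
      using vectorspace_Hom_space[of K V "S 0"] V(1) vectorspace_coordinate_space[of 0]
      by (auto simp: fd_vectorspace_def vectorspace_def module_def abelian_group_def
          intro: abelian_monoid.zero_closed)
    then show ?thesis
      using X_closed[OF V(1) fd_coordinate_space _ V(2)] by (auto simp: Y_def)
  qed
  from count_points_over_nonempty_set[OF Y.functor_subset_axioms this]
  obtain m H f where H: "H \<subseteq> Y m" "H \<noteq> {}" and f: "polynomial_sequence f"
    and card: "\<And>n. card {y \<in> Y (m + n). transport (m + n) m unit_matrix y \<in> H} = q ^ f n"
    by (elim exE conjE) (rule; (assumption | erule spec))
  obtain A :: "rat poly" where A: "\<And>n. poly A (of_nat n) = of_nat (f n)"
    using f by (auto simp: polynomial_sequence_def)
  define h where "h = (\<lambda>p\<in>carrier (P (S m)). if embed m p \<in> H then \<one> else \<zero>)"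
  \<comment> \<open>As h is the indicator function of \<open>H\<close>, inverting it selects exactly
    the points whose projection to K^m lies in \<open>H\<close>, the set already counted for
    matrices.\<close>
  have Sh: "bij_betw (\<lambda>p. embed (m + n) (Pm (sum_space m n) (S (m + n)) (join m n) p))
      (Sh_localized K Pm (S m) X h (S n)) {y \<in> Y (m + n). transport (m + n) m unit_matrix y \<in> H}" for n
  proof -
    let ?j = "Pm (sum_space m n) (S (m + n)) (join m n)"
    let ?s = "Pm (S (m + n)) (sum_space m n) (split m n)"
    have j: "?j p \<in> X (S (m + n))" if "p \<in> X (sum_space m n)" for p
      using X_closed[OF fd_sum_space fd_coordinate_space join_Hom that] .
    have s: "?s x \<in> X (sum_space m n)" if "x \<in> X (S (m + n))" for x
      using X_closed[OF fd_coordinate_space fd_sum_space split_Hom that] .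
    have h: "h (Pm (sum_space m n) (S m) (proj_left (S m) (S n)) p) = \<zero> \<longleftrightarrow>
        transport (m + n) m unit_matrix (embed (m + n) (?j p)) \<notin> H" if "p \<in> X (sum_space m n)" for p
    proof -
      have "?j p \<in> carrier (P (S (m + n)))"
        using X_carrier[OF fd_coordinate_space j[OF that]] .
      then show ?thesis
        using HomD(1)[OF Pm_linear] X_carrier[OF fd_sum_space that]
        by (simp add: Pm_proj_left transport_embed h_def)
    qed
    show ?thesis
    proof (rule bij_betw_byWitness[where f' = "\<lambda>y. ?s (unembed (m + n) y)"])
      show "\<forall>p\<in>Sh_localized K Pm (S m) X h (S n). ?s (unembed (m + n) (embed (m + n) (?j p))) = p"
        using j X_carrier[OF fd_coordinate_space] X_carrier[OF fd_sum_space]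
        by (auto simp: Sh_localized_def Sh_def unembed_embed Pm_split_join)
      show "\<forall>y\<in>{y \<in> Y (m + n). transport (m + n) m unit_matrix y \<in> H}.
          embed (m + n) (?j (?s (unembed (m + n) y))) = y"
        using X_carrier[OF fd_coordinate_space] by (auto simp: Y_def unembed_embed Pm_join_split)
      show "(\<lambda>p. embed (m + n) (?j p)) ` Sh_localized K Pm (S m) X h (S n)
          \<subseteq> {y \<in> Y (m + n). transport (m + n) m unit_matrix y \<in> H}"
        using j h by (auto simp: Sh_localized_def Sh_def Y_def)
      show "(\<lambda>y. ?s (unembed (m + n) y)) ` {y \<in> Y (m + n). transport (m + n) m unit_matrix y \<in> H}
          \<subseteq> Sh_localized K Pm (S m) X h (S n)"
        using s h[OF s] X_carrier[OF fd_coordinate_space]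
        by (auto simp: Sh_localized_def Sh_def Y_def unembed_embed Pm_join_split)
    qed
  qed
  have "finite (Sh_localized K Pm (S m) X h (S n))" for n
    using bij_betw_finite[OF Sh[of n]] finite_subset[OF Y.subset Y.finite] by auto
  moreover have "real (card (Sh_localized K Pm (S m) X h (S n))) = real q powr real_of_rat (poly A (of_nat n))" for n
    using bij_betw_same_card[OF Sh[of n]] card[of n] prime_gt_0_nat[OF prime] A[of n] by (simp add: powr_realpow)
  moreover have "h \<in> functions_on K (P (S m))"
    by (simp add: h_def functions_on_def)
  moreover have "\<exists>p\<in>X (S m). h p \<noteq> \<zero>"
  proof -
    obtain p where "p \<in> X (S m)" "embed m p \<in> H"
      using H by (auto simp: Y_def)
    then show ?thesis
      using X_carrier[OF fd_coordinate_space] by (intro bexI[of _ p]) (auto simp: h_def)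
  qed
  ultimately show ?thesis
    using fd_coordinate_space by blast
qed

end

theorem corollary4p9p1:
  fixes K :: "('k, 'm) ring_scheme"
    and q :: nat
    and P :: "('k, 'a) space \<Rightarrow> ('k, 'w) module"
    and Pm :: "('k, 'a) space \<Rightarrow> ('k, 'a) space
                 \<Rightarrow> (('k, 'a) elem \<Rightarrow> ('k, 'a) elem) \<Rightarrow> ('w \<Rightarrow> 'w)"
    and X :: "('k, 'a) space \<Rightarrow> 'w set"
  assumes "field K"
    and "finite (carrier K)"
    and "card (carrier K) = q"
    and "prime q"
    and "polynomial_generic_representation K P Pm"
    and "is_subset K P Pm X"
    and "nonempty_subset K X"
  shows "\<exists>(U :: ('k, 'a) space) (h :: 'w \<Rightarrow> 'k) (A :: rat poly).
           fd_vectorspace K U \<and>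
           h \<in> functions_on K (P U) \<and>
           (\<exists>p\<in>X U. h p \<noteq> \<zero>\<^bsub>K\<^esub>) \<and>
           (\<forall>n::nat.
              finite (Sh_localized K Pm U X h (coordinate_space K n)) \<and>
              real (card (Sh_localized K Pm U X h (coordinate_space K n)))
                = real q powr real_of_rat (poly A (of_nat n)))"
proof -
  interpret prime_field_representation K q P Pm
    using assms(1-5) by (simp add: prime_field_representation_def prime_field_def prime_field_axioms_def)
  show ?thesis
    using count_shifted_subset[OF assms(6,7)] .
qed

end
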